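(* Let $n,m$ be positive integers, let $G\in\mathcal{I}(n,m)$, and let $H$ be a finitely generated group with $G\approx H$, i.e. $\mathrm{Con}(G)=\mathrm{Con}(H)$. Then $H\in\mathcal{I}(n,m)$.
   Context: Let $G$ be a finitely generated group. Given a finite generating sequence $\mathfrak g=(g_1,\dots,g_k)$ of $G$ and a finite (indexed) partition $\mathcal E=\{E_1,\dots,E_r\}$ of $G$ into nonempty, pairwise disjoint subsets, a configuration corresponding to $(\mathfrak g,\mathcal E)$ is a $(k+1)$-tuple $C=(c_0,c_1,\dots,c_k)$ with $1\le c_i\le r$ for each $i$ such that there is $x\in G$ with $x\in E_{c_0}$ and $g_ix\in E_{c_i}$ for each $1\le i\le k$. The set of all configurations corresponding to $(\mathfrak g,\mathcal E)$ is denoted $\mathrm{Con}(\mathfrak g,\mathcal E)$, and $\mathrm{Con}(G)$ denotes the set of all $\mathrm{Con}(\mathfrak g,\mathcal E)$ as $\mathfrak g$ runs over the finite generating sequences of $G$ and $\mathcal E$ over the finite partitions of $G$. Finitely generated groups $G_1,G_2$ are called configuration equivalent, written $G_1\approx G_2$, if $\mathrm{Con}(G_1)=\mathrm{Con}(G_2)$. For a finitely generated torsion-free nilpotent group $G$ of class $2$, $\tau(G)$ denotes the isolator of the commutator subgroup $G'$ in $G$, i.e. the set of all $x\in G$ such that $x^s\in G'$ for some nonzero integer $s$; it is a central subgroup of $G$, and $\tau(G)/G'$ is the torsion subgroup of $G/G'$. For positive integers $n,m$, $\mathcal{I}(n,m)$ denotes the class of all finitely generated torsion-free nilpotent groups $G$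 of class $2$ such that $G/\tau(G)\cong\mathbb{Z}^n$ and $\tau(G)\cong\mathbb{Z}^m$. *)

theory Defs
  imports "HOL-Algebra.Algebra" "HOL-Library.Disjoint_Sets"
begin

definition finitely_generated :: "('a, 'b) monoid_scheme \<Rightarrow> bool" where
  "finitely_generated G \<longleftrightarrow>
     group G \<and> (\<exists>S. finite S \<and> S \<subseteq> carrier G \<and> generate G S = carrier G)"

definition generating_sequence :: "('a, 'b) monoid_scheme \<Rightarrow> 'a list \<Rightarrow> bool" where
  "generating_sequence G gs \<longleftrightarrow> set gs \<subseteq> carrier G \<and> generate G (set gs) = carrier G"

definition indexed_partition :: "('a, 'b) monoid_scheme \<Rightarrow> nat \<Rightarrow> (nat \<Rightarrow> 'a set) \<Rightarrow> bool" where
  "indexed_partition G r E \<longleftrightarrow>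
     (\<Union>i\<in>{1..r}. E i) = carrier G \<and> disjoint_family_on E {1..r} \<and> (\<forall>i\<in>{1..r}. E i \<noteq> {})"

text \<open>The tuple \<open>(c\<^sub>0, c\<^sub>1, \<dots>, c\<^sub>k)\<close> is a list of length \<open>k + 1\<close>. As lists are indexed from 0, the
  generator \<open>g\<^sub>i\<close> is \<open>gs ! (i - 1)\<close>, so \<open>gs ! i\<close> is matched with \<open>c ! Suc i\<close>. Configurations are
  lists of natural numbers whatever the element type of the group, so configuration sets of
  groups over different types can be compared by equality.\<close>

definition configuration ::
    "('a, 'b) monoid_scheme \<Rightarrow> 'a list \<Rightarrow> nat \<Rightarrow> (nat \<Rightarrow> 'a set) \<Rightarrow> nat list \<Rightarrow> bool" where
  "configuration G gs r E c \<longleftrightarrow>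
     length c = Suc (length gs) \<and> set c \<subseteq> {1..r} \<and>
     (\<exists>x\<in>carrier G. x \<in> E (c ! 0) \<and> (\<forall>i<length gs. gs ! i \<otimes>\<^bsub>G\<^esub> x \<in> E (c ! Suc i)))"

definition Con_pair ::
    "('a, 'b) monoid_scheme \<Rightarrow> 'a list \<Rightarrow> nat \<Rightarrow> (nat \<Rightarrow> 'a set) \<Rightarrow> nat list set" where
  "Con_pair G gs r E = {c. configuration G gs r E c}"

definition Con :: "('a, 'b) monoid_scheme \<Rightarrow> nat list set set" where
  "Con G = {Con_pair G gs r E | gs r E. generating_sequence G gs \<and> indexed_partition G r E}"

definition config_equivalent ::
    "('a, 'b) monoid_scheme \<Rightarrow> ('c, 'd) monoid_scheme \<Rightarrow> bool" where
  "config_equivalent G H \<longleftrightarrow> Con G = Con H"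

definition torsion_free :: "('a, 'b) monoid_scheme \<Rightarrow> bool" where
  "torsion_free G \<longleftrightarrow>
     (\<forall>x\<in>carrier G. \<forall>k::nat. 0 < k \<and> x [^]\<^bsub>G\<^esub> k = \<one>\<^bsub>G\<^esub> \<longrightarrow> x = \<one>\<^bsub>G\<^esub>)"

definition commutator_subgroup ::
    "('a, 'b) monoid_scheme \<Rightarrow> 'a set \<Rightarrow> 'a set \<Rightarrow> 'a set" where
  "commutator_subgroup G A B =
     generate G {a \<otimes>\<^bsub>G\<^esub> b \<otimes>\<^bsub>G\<^esub> inv\<^bsub>G\<^esub> a \<otimes>\<^bsub>G\<^esub> inv\<^bsub>G\<^esub> b | a b. a \<in> A \<and> b \<in> B}"

text \<open>The lower central series, indexed from 0: \<open>lower_central G i\<close> is the term usually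
  written \<open>\<gamma>\<^bsub>i+1\<^esub>(G)\<close>.\<close>

primrec lower_central :: "('a, 'b) monoid_scheme \<Rightarrow> nat \<Rightarrow> 'a set" where
  "lower_central G 0 = carrier G"
| "lower_central G (Suc i) = commutator_subgroup G (lower_central G i) (carrier G)"

text \<open>Nilpotent of class exactly \<open>c\<close>; in particular a group of class 2 is not abelian.\<close>

definition nilpotent_of_class :: "('a, 'b) monoid_scheme \<Rightarrow> nat \<Rightarrow> bool" where
  "nilpotent_of_class G c \<longleftrightarrow>
     lower_central G c = {\<one>\<^bsub>G\<^esub>} \<and> (\<forall>i<c. lower_central G i \<noteq> {\<one>\<^bsub>G\<^esub>})"

definition tau :: "('a, 'b) monoid_scheme \<Rightarrow> 'a set" where
  "tau G = {x \<in> carrier G. \<exists>s::int. s \<noteq> 0 \<and> x [^]\<^bsub>G\<^esub> s \<in> derived G (carrier G)}"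

definition Z_power :: "nat \<Rightarrow> (nat \<Rightarrow> int) monoid" where
  "Z_power n = product_group {..<n} (\<lambda>_. integer_group)"

text \<open>The class \<open>\<I>(n,m)\<close>.\<close>

definition class_I :: "nat \<Rightarrow> nat \<Rightarrow> ('a, 'b) monoid_scheme \<Rightarrow> bool" where
  "class_I n m G \<longleftrightarrow>
     finitely_generated G \<and> torsion_free G \<and> nilpotent_of_class G 2 \<and>
     G Mod tau G \<cong> Z_power n \<and> G\<lparr>carrier := tau G\<rparr> \<cong> Z_power m"

end

theory Submission
  imports Defs
begin

text \<open>A configuration set with a partition into finitely many singletons and a remainder records
  which words are non-trivial, so \<open>G\<close> and \<open>H\<close> satisfy the same laws; a partition into cosets of a
  normal subgroup of finite index shows that they have the same finite quotients. Hence \<open>H\<close> is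
  nilpotent of class 2. Write \<open>K\<^sup>q\<close> for the subgroup generated by the \<open>q\<close>-th powers; for finitely generated class 2
  groups the quotient \<open>K/K\<^sup>q\<close> is finite, so \<open>G/G\<^sup>q\<close> and \<open>H/H\<^sup>q\<close> are isomorphic. In class 2,
  \<open>K\<^bsup>2s\<^esup>\<close> consists of \<open>s\<close>-th powers. A torsion element \<open>t \<noteq> 1\<close> of \<open>H\<close> with \<open>t\<^sup>r = 1\<close> lies outside
  some \<open>H\<^sup>s\<close>; transported to \<open>G/G\<^sup>q\<close> with \<open>q = 2rs\<close> it yields \<open>g\<close> with \<open>g\<^sup>r = z\<^bsup>rs\<^esup>\<close>, so \<open>g = z\<^sup>s\<close>
  by uniqueness of roots in \<open>G\<close>, and \<open>t\<close> would lie in \<open>H\<^sup>s\<close>. So \<open>H\<close> is torsion-free, and the ranks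
  are compared by counting modulo an odd \<open>q\<close> prime to the exponents of \<open>\<tau>/K'\<close> for both groups:
  \<open>q\<^sup>n\<close> is the order of \<open>K/\<tau>K\<^sup>q\<close>, and \<open>q\<^sup>m\<close> that of the derived subgroup of \<open>K/K\<^sup>q\<close>.\<close>

section \<open>Transfer of configurations\<close>

text \<open>The matching generating sequence of \<open>H\<close> depends on the partition chosen in
  \<open>G\<close>, so the hypothesis yields no single map between the groups, only one finite piece
  of information at a time: a word that stays non-trivial, or a homomorphism of \<open>H\<close>
  onto one given finite quotient of \<open>G\<close>. Such a homomorphism is only surjective. Hence
  ranks are compared by inequalities used once in each direction, and injectivity modulo q-th powers
  comes from counting two finite groups that are images of each other. The obstacle in class two is
  that (xy)^n differs from x^n y^n by the power n(n-1)/2 of a commutator, and for positive even n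
  this exponent is not a multiple of n. This is why \<open>2 * s\<close> stands in for s when roots
  are extracted, and why the ranks are counted with an odd q. Finiteness of the quotients and the
  exponents that serve as moduli come from a chain of subgroups with cyclic factors.\<close>

definition same_patterns ::
    "('a, 'b) monoid_scheme \<Rightarrow> 'a list \<Rightarrow> ('a \<Rightarrow> 'k) \<Rightarrow>
      ('c, 'd) monoid_scheme \<Rightarrow> 'c list \<Rightarrow> ('c \<Rightarrow> 'k) \<Rightarrow> bool" where
  "same_patterns G gs \<kappa> H hs \<kappa>' \<longleftrightarrow>
    (\<forall>y\<in>carrier H.
      \<exists>x\<in>carrier G. \<kappa>' y = \<kappa> x \<and> (\<forall>i<length gs. \<kappa>' (hs ! i \<otimes>\<^bsub>H\<^esub> y) = \<kappa> (gs ! i \<otimes>\<^bsub>G\<^esub> x))) \<and>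
    (\<forall>x\<in>carrier G.
      \<exists>y\<in>carrier H. \<kappa>' y = \<kappa> x \<and> (\<forall>i<length gs. \<kappa>' (hs ! i \<otimes>\<^bsub>H\<^esub> y) = \<kappa> (gs ! i \<otimes>\<^bsub>G\<^esub> x)))"

text \<open>The two conjuncts of \<open>same_patterns\<close> are the two inclusions between
  configuration sets, with colours of any type in place of class numbers. Finitely many colours on
  \<open>G\<close> form a partition; the equal configuration set of \<open>H\<close> supplies
  \<open>hs\<close> and classes \<open>F\<close>, whose numbers are translated back into colours.
  The sequence \<open>gs\<close> can be prescribed, \<open>hs\<close> cannot.\<close>

lemma config_transfer:
  fixes \<kappa> :: "'a \<Rightarrow> 'k"
  assumes G: "group G" and H: "group H" and eq: "Con G = Con H"
    and gs: "generating_sequence G gs" and fin: "finite (\<kappa> ` carrier G)"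
  shows "\<exists>hs \<kappa>'. generating_sequence H hs \<and> length hs = length gs \<and>
    same_patterns G gs \<kappa> H hs \<kappa>'"
proof -
  interpret G: group G by fact
  interpret H: group H by fact
  define r where "r = card (\<kappa> ` carrier G)"
  obtain e where e: "bij_betw e {1..r} (\<kappa> ` carrier G)"
    using ex_bij_betw_nat_finite_1[OF fin] unfolding r_def by blast
  define E where "E j = {x \<in> carrier G. \<kappa> x = e j}" for j
  define colG where "colG x = inv_into {1..r} e (\<kappa> x)" for x
  have colG: "colG x \<in> {1..r}" "e (colG x) = \<kappa> x" "x \<in> E (colG x)" if "x \<in> carrier G" for x
  proof -
    have "\<kappa> x \<in> e ` {1..r}" using that e unfolding bij_betw_def by blast
    from inv_into_into[OF this] f_inv_into_f[OF this]
    show "colG x \<in> {1..r}" "e (colG x) = \<kappa> x" "x \<in> E (colG x)"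
      using that unfolding colG_def E_def by auto
  qed
  have "indexed_partition G r E"
    unfolding indexed_partition_def
  proof (intro conjI ballI)
    show "\<Union> (E ` {1..r}) = carrier G"
      using colG by (force simp: E_def)
    show "disjoint_family_on E {1..r}"
      using e unfolding disjoint_family_on_def E_def bij_betw_def inj_on_def by fastforce
    fix i assume "i \<in> {1..r}"
    then have "e i \<in> \<kappa> ` carrier G" using e by (auto simp: bij_betw_def)
    then show "E i \<noteq> {}" unfolding E_def by auto
  qed
  with gs have "Con_pair G gs r E \<in> Con G" unfolding Con_def by blast
  then have "Con_pair G gs r E \<in> Con H" by (simp only: eq)
  then obtain hs r' F where hs: "generating_sequence H hs" and F: "indexed_partition H r' F"
    and Con: "Con_pair G gs r E = Con_pair H hs r' F"
    unfolding Con_def by blast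
  have conf: "configuration G gs r E c \<longleftrightarrow> configuration H hs r' F c" for c
    using Con unfolding Con_pair_def by blast
  define col where "col y = (THE j. j \<in> {1..r'} \<and> y \<in> F j)" for y
  have col_eq: "col y = j" if "j \<in> {1..r'}" "y \<in> F j" for y j
    unfolding col_def
  proof (rule the_equality)
    fix k assume k: "k \<in> {1..r'} \<and> y \<in> F k"
    have "disjoint_family_on F {1..r'}" using F unfolding indexed_partition_def by blast
    then show "k = j" using that k disjoint_family_onD[of F "{1..r'}" k j] by blast
  qed (use that in auto)
  have col: "col y \<in> {1..r'}" "y \<in> F (col y)" if "y \<in> carrier H" for y
  proof -
    have "y \<in> (\<Union>i\<in>{1..r'}. F i)" using that F unfolding indexed_partition_def by simp
    then obtain j where "j \<in> {1..r'}" "y \<in> F j" by (rule UN_E)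
    with col_eq[OF this] show "col y \<in> {1..r'}" "y \<in> F (col y)" by simp_all
  qed
  \<comment> \<open>No comparison of r and r' is made: a class of \<open>F\<close> gets the colour
    with the same number, which is attained in \<open>G\<close> because the number occurs in a
    common configuration.\<close>
  define \<kappa>' where "\<kappa>' y = e (col y)" for y
  have gsc: "gs ! i \<in> carrier G" if "i < length gs" for i
    using gs that unfolding generating_sequence_def by auto
  have hsc: "hs ! i \<in> carrier H" if "i < length hs" for i
    using hs that unfolding generating_sequence_def by auto
  have HG: "configuration G gs r E (col y # map (\<lambda>h. col (h \<otimes>\<^bsub>H\<^esub> y)) hs)"
    if "y \<in> carrier H" for y
  proof -
    have "set (col y # map (\<lambda>h. col (h \<otimes>\<^bsub>H\<^esub> y)) hs) \<subseteq> {1..r'}"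
      using col that hs unfolding generating_sequence_def
      by (auto simp del: atLeastAtMost_iff)
    then show ?thesis
      unfolding conf unfolding configuration_def
      by (intro conjI bexI[OF _ that] allI impI) (use that col hsc in auto)
  qed
  \<comment> \<open>The configuration of the identity is a tuple for both sequences at once, so its
    length determines both.\<close>
  have len: "length hs = length gs"
    using HG[OF H.one_closed] unfolding configuration_def by simp
  have 1: "\<exists>x\<in>carrier G. \<kappa>' y = \<kappa> x \<and> (\<forall>i<length gs. \<kappa>' (hs ! i \<otimes>\<^bsub>H\<^esub> y) = \<kappa> (gs ! i \<otimes>\<^bsub>G\<^esub> x))"
    if y: "y \<in> carrier H" for y
  proof -
    obtain x where x: "x \<in> carrier G" "x \<in> E (col y)"
      "\<And>i. i < length gs \<Longrightarrow> gs ! i \<otimes>\<^bsub>G\<^esub> x \<in> E (col (hs ! i \<otimes>\<^bsub>H\<^esub> y))"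
      using HG[OF y] len unfolding configuration_def by auto
    then show ?thesis unfolding \<kappa>'_def E_def by (intro bexI[of _ x]) auto
  qed
  have 2: "\<exists>y\<in>carrier H. \<kappa>' y = \<kappa> x \<and> (\<forall>i<length gs. \<kappa>' (hs ! i \<otimes>\<^bsub>H\<^esub> y) = \<kappa> (gs ! i \<otimes>\<^bsub>G\<^esub> x))"
    if x: "x \<in> carrier G" for x
  proof -
    let ?c = "colG x # map (\<lambda>g. colG (g \<otimes>\<^bsub>G\<^esub> x)) gs"
    have "set ?c \<subseteq> {1..r}"
      using colG x gs unfolding generating_sequence_def
      by (auto simp del: atLeastAtMost_iff)
    then have "configuration G gs r E ?c"
      unfolding configuration_def
      by (intro conjI bexI[OF _ x] allI impI) (use x colG gsc in auto)
    then have c: "configuration H hs r' F ?c" by (simp add: conf)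
    then obtain y where y: "y \<in> carrier H" "y \<in> F (colG x)"
      "\<And>i. i < length gs \<Longrightarrow> hs ! i \<otimes>\<^bsub>H\<^esub> y \<in> F (colG (gs ! i \<otimes>\<^bsub>G\<^esub> x))"
      using len unfolding configuration_def by auto
    \<comment> \<open>Being a configuration of \<open>H\<close> as well, the tuple has entries at
      most r', as \<open>col_eq\<close> demands.\<close>
    have "set ?c \<subseteq> {1..r'}" using c unfolding configuration_def by blast
    then have "colG x \<in> {1..r'}" "\<And>i. i < length gs \<Longrightarrow> colG (gs ! i \<otimes>\<^bsub>G\<^esub> x) \<in> {1..r'}"
      by (auto simp del: atLeastAtMost_iff)
    then have "col y = colG x" "\<And>i. i < length gs \<Longrightarrow> col (hs ! i \<otimes>\<^bsub>H\<^esub> y) = colG (gs ! i \<otimes>\<^bsub>G\<^esub> x)"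
      using y col_eq by blast+
    then show ?thesis using x y(1) gsc colG(2) unfolding \<kappa>'_def
      by (intro bexI[of _ y]) auto
  qed
  have "same_patterns G gs \<kappa> H hs \<kappa>'" unfolding same_patterns_def using 1 2 by blast
  then show ?thesis using hs len by blast
qed

text \<open>A letter is an index with a sign, \<open>False\<close> meaning the inverse. Letters act
  by left multiplication, as generators do in configurations, so the values of the suffixes of a
  word are the successive vertices of its path from the identity.\<close>

primrec word_val :: "('a, 'b) monoid_scheme \<Rightarrow> 'a list \<Rightarrow> (nat \<times> bool) list \<Rightarrow> 'a" where
  "word_val G gs [] = \<one>\<^bsub>G\<^esub>"
| "word_val G gs (l # w) =
     (if snd l then gs ! fst l else inv\<^bsub>G\<^esub> (gs ! fst l)) \<otimes>\<^bsub>G\<^esub> word_val G gs w"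

lemma (in group) word_val_closed:
  assumes "set gs \<subseteq> carrier G" "\<forall>l\<in>set w. fst l < length gs"
  shows "word_val G gs w \<in> carrier G"
  using assms by (induction w) (auto simp: subset_iff)

text \<open>The vertices of the path spelled by \<open>w\<close> are made singleton classes, so a path spelled by
  \<open>w\<close> in the other group has to follow the same colours, and closes up only if this one does.\<close>

lemma word_val_transfer:
  assumes G: "group G" and H: "group H" and eq: "Con G = Con H"
    and gs: "generating_sequence G gs" and w: "\<forall>l\<in>set w. fst l < length gs"
  obtains hs where "generating_sequence H hs" "length hs = length gs"
    "word_val H hs w = \<one>\<^bsub>H\<^esub> \<longrightarrow> word_val G gs w = \<one>\<^bsub>G\<^esub>"
proof -
  interpret G: group G by fact
  interpret H: group H by fact
  have gsub: "set gs \<subseteq> carrier G" using gs unfolding generating_sequence_def by simp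
  define P where "P = (\<lambda>k. word_val G gs (drop k w)) ` {..length w}"
  then have "finite P" by simp
  define \<kappa> where "\<kappa> x = (if x \<in> P then Some x else None)" for x
  have "finite (\<kappa> ` carrier G)"
    by (rule finite_subset[of _ "insert None (Some ` P)"]) (auto simp: \<kappa>_def \<open>finite P\<close>)
  then obtain hs \<kappa>' where hs: "generating_sequence H hs" "length hs = length gs"
    and pat: "same_patterns G gs \<kappa> H hs \<kappa>'"
    using config_transfer[OF G H eq gs] by blast
  from pat have HG: "\<And>y. y \<in> carrier H \<Longrightarrow>
      \<exists>x\<in>carrier G. \<kappa>' y = \<kappa> x \<and> (\<forall>i<length gs. \<kappa>' (hs ! i \<otimes>\<^bsub>H\<^esub> y) = \<kappa> (gs ! i \<otimes>\<^bsub>G\<^esub> x))"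
    and GH: "\<And>x. x \<in> carrier G \<Longrightarrow>
      \<exists>y\<in>carrier H. \<kappa>' y = \<kappa> x \<and> (\<forall>i<length gs. \<kappa>' (hs ! i \<otimes>\<^bsub>H\<^esub> y) = \<kappa> (gs ! i \<otimes>\<^bsub>G\<^esub> x))"
    unfolding same_patterns_def by blast+
  have \<kappa>P: "\<kappa> x = Some p \<longleftrightarrow> x \<in> P \<and> x = p" for x p
    by (auto simp: \<kappa>_def)
  have hsub: "set hs \<subseteq> carrier H" using hs unfolding generating_sequence_def by simp
  \<comment> \<open>The path in \<open>H\<close> starts at an element coloured like the identity of
    \<open>G\<close>; the identity of \<open>H\<close> itself need not have this colour.\<close>
  obtain y0 where y0: "y0 \<in> carrier H" "\<kappa>' y0 = \<kappa> \<one>\<^bsub>G\<^esub>" using GH[OF G.one_closed] by blast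
  have "\<one>\<^bsub>G\<^esub> \<in> P" unfolding P_def by (auto simp: image_iff intro!: bexI[of _ "length w"])
  then have y0': "\<kappa>' y0 = Some \<one>\<^bsub>G\<^esub>" using y0 by (simp add: \<kappa>_def)
  \<comment> \<open>The prefix \<open>v\<close> records that \<open>u\<close> is a suffix of
    \<open>w\<close>; this puts the vertex into \<open>P\<close>, where the colour determines the
    element.\<close>
  have path: "w = v @ u \<Longrightarrow> \<kappa>' (word_val H hs u \<otimes>\<^bsub>H\<^esub> y0) = Some (word_val G gs u)" for u v
  proof (induction u arbitrary: v)
    case Nil
    then show ?case using y0 y0' by simp
  next
    case (Cons l u)
    have u: "\<kappa>' (word_val H hs u \<otimes>\<^bsub>H\<^esub> y0) = Some (word_val G gs u)"
      using Cons.IH[of "v @ [l]"] Cons.prems by simp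
    have P: "word_val G gs (l # u) \<in> P" using Cons.prems unfolding P_def
      by (auto simp: image_iff intro!: bexI[of _ "length v"])
    have lu: "fst l < length gs" "\<forall>l\<in>set u. fst l < length gs" using w Cons.prems by auto
    note cl = G.word_val_closed[OF gsub lu(2)] H.word_val_closed[OF hsub lu(2)[folded hs(2)]]
    have g: "gs ! fst l \<in> carrier G" and h: "hs ! fst l \<in> carrier H"
      using lu gsub hsub hs(2) by (auto simp: subset_iff)
    show ?case
    proof (cases "snd l")
      case True
      obtain x where x: "x \<in> carrier G" "\<kappa>' (word_val H hs u \<otimes>\<^bsub>H\<^esub> y0) = \<kappa> x"
        "\<kappa>' (hs ! fst l \<otimes>\<^bsub>H\<^esub> (word_val H hs u \<otimes>\<^bsub>H\<^esub> y0)) = \<kappa> (gs ! fst l \<otimes>\<^bsub>G\<^esub> x)"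
        using HG[of "word_val H hs u \<otimes>\<^bsub>H\<^esub> y0"] cl y0 lu by auto
      have "x = word_val G gs u" using x(2) u \<kappa>P by metis
      with x(3) True P have "\<kappa>' (hs ! fst l \<otimes>\<^bsub>H\<^esub> (word_val H hs u \<otimes>\<^bsub>H\<^esub> y0)) = Some (word_val G gs (l # u))"
        by (simp add: \<kappa>_def)
      then show ?thesis using True h cl y0 by (simp add: H.m_assoc)
    next
      case False
      \<comment> \<open>An inverse letter is an edge traversed backwards: the pattern is taken at
        its far end \<open>?y\<close>, from which the generator leads back to the known
        vertex.\<close>
      let ?y = "inv\<^bsub>H\<^esub> (hs ! fst l) \<otimes>\<^bsub>H\<^esub> (word_val H hs u \<otimes>\<^bsub>H\<^esub> y0)"
      have "hs ! fst l \<otimes>\<^bsub>H\<^esub> ?y = word_val H hs u \<otimes>\<^bsub>H\<^esub> y0"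
        using h cl y0 by (simp add: H.m_assoc[symmetric])
      then obtain x where x: "x \<in> carrier G" "\<kappa>' ?y = \<kappa> x"
        "\<kappa>' (word_val H hs u \<otimes>\<^bsub>H\<^esub> y0) = \<kappa> (gs ! fst l \<otimes>\<^bsub>G\<^esub> x)"
        using HG[of ?y] cl y0 lu h by (metis H.inv_closed H.m_closed)
      have "gs ! fst l \<otimes>\<^bsub>G\<^esub> x = word_val G gs u" using x(3) u \<kappa>P by metis
      then have "x = word_val G gs (l # u)" using False g x(1)
        by (simp add: G.inv_solve_left cl)
      with x(2) P have "\<kappa>' ?y = Some (word_val G gs (l # u))" by (simp add: \<kappa>_def)
      then show ?thesis using False h cl y0 by (simp add: H.m_assoc)
    qed
  qed
  have "word_val G gs w = \<one>\<^bsub>G\<^esub>" if "word_val H hs w = \<one>\<^bsub>H\<^esub>"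
    using path[of "[]" w] that y0 y0' by simp
  with hs that show thesis by blast
qed

text \<open>The word transfer carries triviality from the uncontrolled sequence to the chosen one,
  so the sequence has to be chosen in \<open>H\<close>. Arbitrary elements need not generate, so
  they are completed by generators; the matching sequence in \<open>G\<close> is equally long, which
  is why the law is stated for lists of length at least k.\<close>

lemma law_transfer:
  assumes G: "group G" and H: "finitely_generated H" and eq: "Con G = Con H"
    and w: "\<forall>l\<in>set w. fst l < k"
    and law: "\<And>gs. set gs \<subseteq> carrier G \<Longrightarrow> length gs \<ge> k \<Longrightarrow> word_val G gs w = \<one>\<^bsub>G\<^esub>"
    and hs: "set hs \<subseteq> carrier H" "length hs = k"
  shows "word_val H hs w = \<one>\<^bsub>H\<^esub>"
proof -
  have gH: "group H" using H by (simp add: finitely_generated_def)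
  interpret H: group H by fact
  obtain S where "finite S" "S \<subseteq> carrier H" "generate H S = carrier H"
    using H unfolding finitely_generated_def by blast
  then obtain ss where ss: "set ss \<subseteq> carrier H" "generate H (set ss) = carrier H"
    using finite_list by metis
  have "generate H (set (hs @ ss)) = carrier H"
    using H.mono_generate[of "set ss" "set (hs @ ss)"] H.generate_incl[of "set (hs @ ss)"] ss hs by auto
  then have gen: "generating_sequence H (hs @ ss)"
    using ss hs by (auto simp: generating_sequence_def)
  have w': "\<forall>l\<in>set w. fst l < length (hs @ ss)" using w hs by fastforce
  obtain gs where gs: "generating_sequence G gs" "length gs = length (hs @ ss)"
    "word_val G gs w = \<one>\<^bsub>G\<^esub> \<longrightarrow> word_val H (hs @ ss) w = \<one>\<^bsub>H\<^esub>"
    using word_val_transfer[OF gH G eq[symmetric] gen w'] .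
  have "word_val H (hs @ ss) w = \<one>\<^bsub>H\<^esub>"
    using gs law hs unfolding generating_sequence_def by auto
  moreover have "word_val H (hs @ ss) w = word_val H hs w"
    using w by (induction w) (auto simp: nth_append hs)
  ultimately show ?thesis by simp
qed

text \<open>Colour \<open>G\<close> by the cosets of \<open>N\<close>. A pattern at y then says that
  multiplying y by \<open>hs ! i\<close> multiplies its colour by the coset of
  \<open>gs ! i\<close>, so the colouring of \<open>H\<close>, read from a suitable base point, is a
  homomorphism. It is onto because the cosets of the \<open>gs ! i\<close> generate.\<close>

lemma finite_quotient_transfer:
  assumes G: "finitely_generated G" and H: "group H" and eq: "Con G = Con H"
    and N: "N \<lhd> G" and fin: "finite (rcosets\<^bsub>G\<^esub> N)"
  obtains \<phi> where "\<phi> \<in> hom H (G Mod N)" "\<phi> ` carrier H = carrier (G Mod N)"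
proof -
  have gG: "group G" using G by (simp add: finitely_generated_def)
  interpret G: group G by fact
  interpret H: group H by fact
  interpret N: normal N G by fact
  interpret Q: group "G Mod N" by (rule N.factorgroup_is_group)
  note [simp del] = one_FactGroup mult_FactGroup
  obtain S where S: "finite S" "S \<subseteq> carrier G" "generate G S = carrier G"
    using G unfolding finitely_generated_def by blast
  then obtain gs where gs: "generating_sequence G gs"
    using finite_list unfolding generating_sequence_def by metis
  define \<kappa> where "\<kappa> x = N #>\<^bsub>G\<^esub> x" for x
  have \<kappa>_hom: "\<kappa> (x \<otimes>\<^bsub>G\<^esub> y) = \<kappa> x \<otimes>\<^bsub>G Mod N\<^esub> \<kappa> y" "\<kappa> x \<in> carrier (G Mod N)"
    if "x \<in> carrier G" "y \<in> carrier G" for x y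
    using N.r_coset_hom_Mod that unfolding \<kappa>_def hom_def by auto
  have "\<kappa> ` carrier G = rcosets\<^bsub>G\<^esub> N" unfolding \<kappa>_def RCOSETS_def by auto
  then have "finite (\<kappa> ` carrier G)" using fin by simp
  then obtain hs \<kappa>' where hs: "generating_sequence H hs" "length hs = length gs"
    and pat: "same_patterns G gs \<kappa> H hs \<kappa>'"
    using config_transfer[OF gG H eq gs] by blast
  from pat have HG: "\<And>y. y \<in> carrier H \<Longrightarrow>
      \<exists>x\<in>carrier G. \<kappa>' y = \<kappa> x \<and> (\<forall>i<length gs. \<kappa>' (hs ! i \<otimes>\<^bsub>H\<^esub> y) = \<kappa> (gs ! i \<otimes>\<^bsub>G\<^esub> x))"
    and GH: "\<And>x. x \<in> carrier G \<Longrightarrow>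
      \<exists>y\<in>carrier H. \<kappa>' y = \<kappa> x \<and> (\<forall>i<length gs. \<kappa>' (hs ! i \<otimes>\<^bsub>H\<^esub> y) = \<kappa> (gs ! i \<otimes>\<^bsub>G\<^esub> x))"
    unfolding same_patterns_def by blast+
  obtain y0 where y0: "y0 \<in> carrier H" "\<kappa>' y0 = \<kappa> \<one>\<^bsub>G\<^esub>" using GH[OF G.one_closed] by blast
  \<comment> \<open>Right translation by \<open>y0\<close> makes the colour of the identity trivial
    and commutes with left multiplication by generators.\<close>
  define \<phi> where "\<phi> y = \<kappa>' (y \<otimes>\<^bsub>H\<^esub> y0)" for y
  have gsc: "gs ! i \<in> carrier G" and hsc: "hs ! i \<in> carrier H" if "i < length gs" for i
    using gs hs that unfolding generating_sequence_def by (auto simp: subset_iff)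
  have cl: "\<phi> y \<in> carrier (G Mod N)" if "y \<in> carrier H" for y
  proof -
    have "y \<otimes>\<^bsub>H\<^esub> y0 \<in> carrier H" using that y0 by simp
    from HG[OF this] obtain x where "x \<in> carrier G" "\<kappa>' (y \<otimes>\<^bsub>H\<^esub> y0) = \<kappa> x" by blast
    then show ?thesis using \<kappa>_hom by (simp add: \<phi>_def)
  qed
  have step: "\<phi> (hs ! i \<otimes>\<^bsub>H\<^esub> y) = \<kappa> (gs ! i) \<otimes>\<^bsub>G Mod N\<^esub> \<phi> y"
    if i: "i < length gs" and y: "y \<in> carrier H" for i y
  proof -
    have "y \<otimes>\<^bsub>H\<^esub> y0 \<in> carrier H" using y y0 by simp
    from HG[OF this] i obtain x where "x \<in> carrier G" "\<kappa>' (y \<otimes>\<^bsub>H\<^esub> y0) = \<kappa> x"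
      "\<kappa>' (hs ! i \<otimes>\<^bsub>H\<^esub> (y \<otimes>\<^bsub>H\<^esub> y0)) = \<kappa> (gs ! i \<otimes>\<^bsub>G\<^esub> x)" by blast
    then show ?thesis using \<kappa>_hom gsc[OF i] hsc[OF i] y y0 by (simp add: \<phi>_def H.m_assoc)
  qed
  have \<phi>_one: "\<phi> \<one>\<^bsub>H\<^esub> = \<one>\<^bsub>G Mod N\<^esub>"
    using y0 by (simp add: \<phi>_def \<kappa>_def FactGroup_def N.subset)
  have gen: "\<phi> (hs ! i) = \<kappa> (gs ! i)" if i: "i < length gs" for i
    using step[OF i, of "\<one>\<^bsub>H\<^esub>"] \<phi>_one hsc[OF i] \<kappa>_hom(2)[OF gsc[OF i] gsc[OF i]]
    by (metis H.one_closed H.r_one Q.r_one)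
  have mult: "\<forall>y\<in>carrier H. \<phi> (x \<otimes>\<^bsub>H\<^esub> y) = \<phi> x \<otimes>\<^bsub>G Mod N\<^esub> \<phi> y" if x: "x \<in> generate H (set hs)" for x
    using x
  proof induction
    case one
    then show ?case using \<phi>_one cl by simp
  next
    case (incl h)
    then obtain i where i: "i < length gs" "h = hs ! i" using hs(2) by (metis in_set_conv_nth)
    then show ?case using step gen by simp
  next
    case (inv h)
    then obtain i where i: "i < length gs" "h = hs ! i" using hs(2) by (metis in_set_conv_nth)
    have h: "h \<in> carrier H" using hsc i by simp
    have *: "\<phi> (inv\<^bsub>H\<^esub> h \<otimes>\<^bsub>H\<^esub> y) = inv\<^bsub>G Mod N\<^esub> (\<phi> h) \<otimes>\<^bsub>G Mod N\<^esub> \<phi> y" if y: "y \<in> carrier H" for y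
    proof -
      have "\<phi> (h \<otimes>\<^bsub>H\<^esub> (inv\<^bsub>H\<^esub> h \<otimes>\<^bsub>H\<^esub> y)) = \<phi> h \<otimes>\<^bsub>G Mod N\<^esub> \<phi> (inv\<^bsub>H\<^esub> h \<otimes>\<^bsub>H\<^esub> y)"
        using step[OF i(1)] gen[OF i(1)] h y i(2) by simp
      moreover have "h \<otimes>\<^bsub>H\<^esub> (inv\<^bsub>H\<^esub> h \<otimes>\<^bsub>H\<^esub> y) = y" using h y by (simp add: H.m_assoc[symmetric])
      ultimately show ?thesis using h y cl by (simp add: Q.inv_solve_left)
    qed
    show ?case
    proof
      fix y assume y: "y \<in> carrier H"
      have "\<phi> (inv\<^bsub>H\<^esub> h) = inv\<^bsub>G Mod N\<^esub> (\<phi> h)"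
        using *[of "\<one>\<^bsub>H\<^esub>"] h \<phi>_one cl by simp
      with *[OF y] show "\<phi> (inv\<^bsub>H\<^esub> h \<otimes>\<^bsub>H\<^esub> y) = \<phi> (inv\<^bsub>H\<^esub> h) \<otimes>\<^bsub>G Mod N\<^esub> \<phi> y" by simp
    qed
  next
    case (eng a b)
    then have "a \<in> carrier H" "b \<in> carrier H"
      using H.generate_incl hs unfolding generating_sequence_def by blast+
    then show ?case using eng.IH cl by (simp add: H.m_assoc Q.m_assoc)
  qed
  then have hom: "\<phi> \<in> hom H (G Mod N)"
    using cl hs unfolding generating_sequence_def hom_def by auto
  then interpret \<phi>: group_hom H "G Mod N" \<phi>
    by unfold_locales
  have "generate (G Mod N) (\<kappa> ` set gs) = \<kappa> ` generate G (set gs)"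
  proof -
    interpret \<kappa>: group_hom G "G Mod N" \<kappa>
      using \<kappa>_hom by unfold_locales (auto simp: hom_def)
    show ?thesis using \<kappa>.generate_img gs unfolding generating_sequence_def by simp
  qed
  also have "\<dots> = carrier (G Mod N)"
    using gs unfolding generating_sequence_def \<kappa>_def FactGroup_def RCOSETS_def by auto
  also have "\<kappa> ` set gs = \<phi> ` set hs"
    using gen hs(2) by (auto simp: in_set_conv_nth image_iff) (metis nth_mem)+
  finally have "generate (G Mod N) (\<phi> ` set hs) = carrier (G Mod N)" .
  then have "\<phi> ` carrier H = carrier (G Mod N)"
    using \<phi>.generate_img hs unfolding generating_sequence_def by metis
  with hom that show thesis by blast
qed

section \<open>Groups of nilpotency class two\<close>

abbreviation comm :: "('a, 'b) monoid_scheme \<Rightarrow> 'a \<Rightarrow> 'a \<Rightarrow> 'a" where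
  "comm G x y \<equiv> x \<otimes>\<^bsub>G\<^esub> y \<otimes>\<^bsub>G\<^esub> inv\<^bsub>G\<^esub> x \<otimes>\<^bsub>G\<^esub> inv\<^bsub>G\<^esub> y"

definition center :: "('a, 'b) monoid_scheme \<Rightarrow> 'a set" where
  "center G = {z \<in> carrier G. \<forall>x\<in>carrier G. z \<otimes>\<^bsub>G\<^esub> x = x \<otimes>\<^bsub>G\<^esub> z}"

definition power_subgroup :: "('a, 'b) monoid_scheme \<Rightarrow> nat \<Rightarrow> 'a set" where
  "power_subgroup G q = generate G ((\<lambda>x. x [^]\<^bsub>G\<^esub> q) ` carrier G)"

context group
begin

text \<open>Together with \<open>m_assoc\<close> these cancellations reduce right-nested products,
  which is how the commutator identities below are simplified.\<close>

lemma inv_assoc_cancel [simp]: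
  "\<lbrakk>x \<in> carrier G; y \<in> carrier G\<rbrakk> \<Longrightarrow> inv x \<otimes> (x \<otimes> y) = y"
  "\<lbrakk>x \<in> carrier G; y \<in> carrier G\<rbrakk> \<Longrightarrow> x \<otimes> (inv x \<otimes> y) = y"
  by (simp_all add: m_assoc[symmetric])

lemma subgroup_center: "subgroup (center G) G"
proof (rule subgroupI)
  fix a assume a: "a \<in> center G"
  then have ac: "a \<in> carrier G" unfolding center_def by blast
  have "inv a \<otimes> x = x \<otimes> inv a" if x: "x \<in> carrier G" for x
  proof -
    have "a \<otimes> x = x \<otimes> a" using a x unfolding center_def by blast
    then have "x = inv a \<otimes> (x \<otimes> a)" using ac x by (metis inv_assoc_cancel(1))
    then have "x \<otimes> inv a = inv a \<otimes> (x \<otimes> a) \<otimes> inv a" by simp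
    then show ?thesis using ac x by (simp add: m_assoc)
  qed
  then show "inv a \<in> center G" using ac unfolding center_def by blast
next
  fix a b assume a: "a \<in> center G" and b: "b \<in> center G"
  then have cl: "a \<in> carrier G" "b \<in> carrier G" unfolding center_def by auto
  have "a \<otimes> b \<otimes> x = x \<otimes> (a \<otimes> b)" if x: "x \<in> carrier G" for x
  proof -
    have "a \<otimes> b \<otimes> x = a \<otimes> (x \<otimes> b)" using b x cl unfolding center_def by (simp add: m_assoc)
    also have "\<dots> = x \<otimes> a \<otimes> b" using a x cl unfolding center_def by (simp add: m_assoc[symmetric])
    finally show ?thesis using x cl by (simp add: m_assoc)
  qed
  then show "a \<otimes> b \<in> center G" using cl unfolding center_def by blast
next
  have "\<one> \<in> center G" by (simp add: center_def)
  then show "center G \<noteq> {}" by blast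
qed (simp add: center_def)

lemma subgroup_nat_pow_closed: "\<lbrakk>subgroup K G; x \<in> K\<rbrakk> \<Longrightarrow> x [^] (n::nat) \<in> K"
  by (induction n) (auto simp: subgroup.one_closed subgroup.m_closed)

lemma subgroup_int_pow_closed: "\<lbrakk>subgroup K G; x \<in> K\<rbrakk> \<Longrightarrow> x [^] (i::int) \<in> K"
  using int_pow_consistent[of K x i] group.int_pow_closed[OF subgroup_imp_group[of K], of x i] by simp

lemma subgroup_central_imp_normal:
  assumes "subgroup K G" "K \<subseteq> center G" shows "K \<lhd> G"
proof (rule normal_invI[OF assms(1)])
  fix x h assume "x \<in> carrier G" "h \<in> K"
  then have "h \<in> carrier G" "h \<otimes> x = x \<otimes> h" using assms(2) unfolding center_def by auto
  then have "x \<otimes> h \<otimes> inv x = h"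
    using \<open>x \<in> carrier G\<close> by (metis inv_closed m_assoc r_inv r_one)
  then show "x \<otimes> h \<otimes> inv x \<in> K" using \<open>h \<in> K\<close> by simp
qed

lemma subgroup_derived_imp_normal:
  assumes K: "subgroup K G" and "derived G (carrier G) \<subseteq> K" shows "K \<lhd> G"
proof (rule normal_invI[OF K])
  fix x h assume x: "x \<in> carrier G" and h: "h \<in> K"
  have hc: "h \<in> carrier G" using h K subgroup.subset by blast
  have "comm G x h \<in> derived G (carrier G)"
    unfolding derived_def using x hc by (intro generate.incl) blast
  then have "comm G x h \<otimes> h \<in> K" using assms(2) h subgroup.m_closed[OF K] by blast
  then show "x \<otimes> h \<otimes> inv x \<in> K" using x hc by (simp add: m_assoc)
qed

lemma power_subgroup_normal: "power_subgroup G q \<lhd> G"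
  unfolding power_subgroup_def
proof (rule normal_generateI)
  fix h g assume "h \<in> (\<lambda>x. x [^] q) ` carrier G" and g: "g \<in> carrier G"
  then obtain x where x: "x \<in> carrier G" "h = x [^] q" by blast
  have "(g \<otimes> x \<otimes> inv g) [^] n = g \<otimes> x [^] n \<otimes> inv g" for n :: nat
    using g x(1) by (induction n) (simp_all add: m_assoc)
  then have "g \<otimes> h \<otimes> inv g = (g \<otimes> x \<otimes> inv g) [^] q" using x(2) by simp
  then show "g \<otimes> h \<otimes> inv g \<in> (\<lambda>x. x [^] q) ` carrier G" using g x(1) by blast
qed auto

lemma power_in_power_subgroup: "x \<in> carrier G \<Longrightarrow> x [^] q \<in> power_subgroup G q"
  unfolding power_subgroup_def by (intro generate.incl) blast

end

text \<open>Class at most two: abelian groups are included, so the locale expresses a law. Class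
  exactly two adds a non-trivial derived subgroup, see
  \<open>nilpotent_of_class_2_iff\<close>.\<close>

locale class_two_group = group +
  assumes comm_central: "\<lbrakk>x \<in> carrier G; y \<in> carrier G\<rbrakk> \<Longrightarrow> comm G x y \<in> center G"
begin

lemma comm_commutes: "\<lbrakk>x \<in> carrier G; y \<in> carrier G; z \<in> carrier G\<rbrakk> \<Longrightarrow> comm G x y \<otimes> z = z \<otimes> comm G x y"
  using comm_central unfolding center_def by blast

lemma derived_central: "derived G (carrier G) \<subseteq> center G"
  unfolding derived_def by (rule generate_subgroup_incl[OF _ subgroup_center]) (use comm_central in blast)

lemma mult_eq_comm_mult: "\<lbrakk>x \<in> carrier G; y \<in> carrier G\<rbrakk> \<Longrightarrow> x \<otimes> y = comm G x y \<otimes> (y \<otimes> x)"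
  by (simp add: m_assoc)

text \<open>In any group [xy,z] = x [y,z] x^{-1} [x,z]; a central [y,z] is unaffected by the
  conjugation.\<close>

lemma comm_mult_left:
  assumes "x \<in> carrier G" "y \<in> carrier G" "z \<in> carrier G"
  shows "comm G (x \<otimes> y) z = comm G x z \<otimes> comm G y z"
proof -
  have "comm G (x \<otimes> y) z = x \<otimes> comm G y z \<otimes> (z \<otimes> inv x \<otimes> inv z)"
    using assms by (simp add: m_assoc inv_mult_group)
  also have "\<dots> = comm G y z \<otimes> x \<otimes> (z \<otimes> inv x \<otimes> inv z)"
    using comm_commutes[of y z x] assms by simp
  also have "\<dots> = comm G y z \<otimes> comm G x z" using assms by (simp add: m_assoc)
  finally show ?thesis using comm_commutes[of y z "comm G x z"] assms by simp
qed

lemma comm_pow_left: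
  assumes "x \<in> carrier G" "y \<in> carrier G"
  shows "comm G (x [^] (n::nat)) y = comm G x y [^] n"
proof (induction n)
  case (Suc n)
  have "comm G (x [^] n \<otimes> x) y = comm G (x [^] n) y \<otimes> comm G x y"
    by (rule comm_mult_left) (use assms in auto)
  with Suc show ?case by simp
qed (use assms in simp)

lemma inv_comm: "\<lbrakk>x \<in> carrier G; y \<in> carrier G\<rbrakk> \<Longrightarrow> inv (comm G x y) = comm G y x"
  by (simp add: inv_mult_group m_assoc)

text \<open>Collecting: from n to n + 1 the new x moves left past y^n at the cost of [y,x]^n, and (n
  choose 2) + n = (n + 1 choose 2).\<close>

lemma pow_mult_class_two:
  assumes x: "x \<in> carrier G" and y: "y \<in> carrier G"
  shows "(x \<otimes> y) [^] n = x [^] n \<otimes> y [^] n \<otimes> comm G y x [^] (n choose 2)"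
proof (induction n)
  case (Suc n)
  define c where "c = comm G y x"
  have c: "c \<in> carrier G" unfolding c_def using x y by simp
  have central: "c [^] k \<otimes> z = z \<otimes> c [^] k" if "z \<in> carrier G" for k :: nat and z
    using subgroup_nat_pow_closed[OF subgroup_center comm_central[OF y x], of k] that
    unfolding center_def c_def by blast
  have "comm G (y [^] n) x = c [^] n" unfolding c_def using comm_pow_left x y by simp
  then have yx: "y [^] n \<otimes> x = c [^] n \<otimes> (x \<otimes> y [^] n)"
    using x y mult_eq_comm_mult[of "y [^] n" x] by simp
  have "(x \<otimes> y) [^] Suc n = x [^] n \<otimes> y [^] n \<otimes> (c [^] (n choose 2) \<otimes> (x \<otimes> y))"
    using Suc[folded c_def] x y c by (simp add: m_assoc)
  also have "\<dots> = x [^] n \<otimes> (y [^] n \<otimes> x) \<otimes> (y \<otimes> c [^] (n choose 2))"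
    using x y c central[of "x \<otimes> y"] by (simp add: m_assoc)
  also have "\<dots> = x [^] n \<otimes> (c [^] n \<otimes> (x \<otimes> (y [^] n \<otimes> (y \<otimes> c [^] (n choose 2)))))"
    using x y c by (simp add: yx m_assoc)
  also have "\<dots> = x [^] n \<otimes> (x \<otimes> (y [^] n \<otimes> (y \<otimes> c [^] (n choose 2)))) \<otimes> c [^] n"
    using x y c central[of "x \<otimes> (y [^] n \<otimes> (y \<otimes> c [^] (n choose 2)))" n] by (simp add: m_assoc)
  also have "\<dots> = x [^] Suc n \<otimes> y [^] Suc n \<otimes> c [^] (Suc n choose 2)"
    using x y c by (simp add: m_assoc nat_pow_mult numeral_2_eq_2 add.commute)
  finally show ?case unfolding c_def .
qed (use assms in \<open>simp add: numeral_2_eq_2\<close>)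

lemma center_pow_mult:
  assumes "x \<in> carrier G" "z \<in> center G"
  shows "(x \<otimes> z) [^] (n::nat) = x [^] n \<otimes> z [^] n"
  using assms unfolding center_def by (intro pow_mult_distrib) auto

text \<open>Products of a (2s)-th power with the s-th power of a central element are closed under
  multiplication: the correction has exponent (2s choose 2) = (2s-1)s, hence is again a central s-th
  power. Each such product is (x^2 d)^s.\<close>

lemma power_subgroup_even:
  assumes "y \<in> power_subgroup G (2 * s)"
  obtains z where "z \<in> carrier G" "y = z [^] s"
proof -
  interpret Z: subgroup "center G" G by (rule subgroup_center)
  have "\<exists>x\<in>carrier G. \<exists>d\<in>center G. y = x [^] (2 * s) \<otimes> d [^] s"
    using assms unfolding power_subgroup_def
  proof induction
    case one
    then show ?case by (intro bexI[of _ \<one>]) auto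
  next
    case (incl h)
    then show ?case by (force intro: bexI[of _ \<one>])
  next
    case (inv h)
    then obtain x where "x \<in> carrier G" "h = x [^] (2 * s)" by blast
    then show ?case by (intro bexI[of _ "inv x"] bexI[of _ \<one>]) (auto simp: nat_pow_inv)
  next
    case (eng a b)
    then obtain x d y e where *: "x \<in> carrier G" "d \<in> center G" "a = x [^] (2 * s) \<otimes> d [^] s"
      "y \<in> carrier G" "e \<in> center G" "b = y [^] (2 * s) \<otimes> e [^] s" by blast
    define c where "c = comm G y x"
    have c: "c \<in> center G" unfolding c_def using * comm_central by simp
    note cl = *(1,4) Z.mem_carrier[OF c] Z.mem_carrier[OF *(2)] Z.mem_carrier[OF *(5)]
    have com: "z [^] k \<otimes> w = w \<otimes> z [^] k" if "z \<in> center G" "w \<in> carrier G" for z w and k :: nat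
      using subgroup_nat_pow_closed[OF subgroup_center that(1), of k] that(2) unfolding center_def by blast
    have "(2 * s) choose 2 = (2 * s - 1) * s" by (simp add: choose_two)
    then have p: "(x \<otimes> y) [^] (2 * s) = x [^] (2 * s) \<otimes> y [^] (2 * s) \<otimes> (c [^] (2 * s - 1)) [^] s"
      using pow_mult_class_two[OF *(1,4), of "2 * s"] cl by (simp add: c_def[symmetric] nat_pow_pow)
    \<comment> \<open>Chosen so that c^(2s-1) w = d e: it undoes the commutator correction of
      (xy)^(2s) and collects the central factors of a and b.\<close>
    define w where "w = inv (c [^] (2 * s - 1)) \<otimes> (d \<otimes> e)"
    have w: "w \<in> center G"
      unfolding w_def using c *(2,5) subgroup_nat_pow_closed[OF subgroup_center c] by blast
    have k: "c [^] (2 * s - 1) \<in> carrier G" using cl by simp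
    have "(c [^] (2 * s - 1) \<otimes> w) [^] s = (d \<otimes> e) [^] s" using cl k by (simp add: w_def)
    then have "(c [^] (2 * s - 1)) [^] s \<otimes> w [^] s = d [^] s \<otimes> e [^] s"
      using center_pow_mult[OF k w, of s] center_pow_mult[of d e s] cl *(5) by simp
    then have "(x \<otimes> y) [^] (2 * s) \<otimes> w [^] s = x [^] (2 * s) \<otimes> y [^] (2 * s) \<otimes> (d [^] s \<otimes> e [^] s)"
      using p cl k Z.mem_carrier[OF w] by (simp add: m_assoc)
    also have "\<dots> = a \<otimes> b" using * cl com[OF *(2), of "y [^] (2 * s)" s]
      by (simp add: m_assoc) (simp add: m_assoc[symmetric])
    finally show ?case using cl w by (intro bexI[of _ "x \<otimes> y"] bexI[of _ w]) auto
  qed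
  then obtain x d where *: "x \<in> carrier G" "d \<in> center G" "y = x [^] (2 * s) \<otimes> d [^] s" by blast
  then have "y = (x [^] (2::nat) \<otimes> d) [^] s"
    using center_pow_mult[of "x [^] (2::nat)" d s] by (simp add: nat_pow_pow)
  then show thesis using that[of "x [^] (2::nat) \<otimes> d"] * by auto
qed

text \<open>For odd q the correction exponent (q choose 2) = q (q-1)/2 is a multiple of q, so the
  correction is absorbed into the root and the q-th powers themselves are closed under
  multiplication.\<close>

lemma power_subgroup_odd:
  assumes "odd q" "y \<in> power_subgroup G q"
  obtains z where "z \<in> carrier G" "y = z [^] q"
proof -
  interpret Z: subgroup "center G" G by (rule subgroup_center)
  have "\<exists>x\<in>carrier G. y = x [^] q"
    using assms(2) unfolding power_subgroup_def
  proof induction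
    case one
    then show ?case by (intro bexI[of _ \<one>]) auto
  next
    case (incl h)
    then show ?case by blast
  next
    case (inv h)
    then show ?case by (force simp: nat_pow_inv intro: bexI[of _ "inv _"])
  next
    case (eng a b)
    then obtain x y where *: "x \<in> carrier G" "a = x [^] q" "y \<in> carrier G" "b = y [^] q" by blast
    define c where "c = comm G y x"
    have c: "c \<in> center G" unfolding c_def using * comm_central by simp
    define k where "k = (q - 1) div 2"
    have "q choose 2 = k * q"
      using assms(1) by (auto elim!: oddE simp: choose_two k_def)
    then have "(x \<otimes> y) [^] q = x [^] q \<otimes> y [^] q \<otimes> (c [^] k) [^] q"
      using pow_mult_class_two[OF *(1,3), of q] Z.mem_carrier[OF c] by (simp add: c_def[symmetric] nat_pow_pow)
    moreover have ck: "inv (c [^] k) \<in> center G"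
      using subgroup_nat_pow_closed[OF subgroup_center c] by blast
    ultimately have "(x \<otimes> y \<otimes> inv (c [^] k)) [^] q = a \<otimes> b"
      using center_pow_mult[of "x \<otimes> y" "inv (c [^] k)" q] * Z.mem_carrier[OF c]
      by (simp add: m_assoc nat_pow_inv)
    then show ?case using * Z.mem_carrier[OF ck] by (metis m_closed)
  qed
  then show thesis using that by blast
qed

end

section \<open>Polycyclic chains\<close>

context group
begin

text \<open>For normal \<open>A\<close> this is the subgroup generated by x and \<open>A\<close>.
  Writing it as a union of cosets x^i A keeps the exponent i at hand, on which the later division
  arguments act.\<close>

definition cyc_ext :: "'a \<Rightarrow> 'a set \<Rightarrow> 'a set" where
  "cyc_ext x A = (\<Union>i::int. (x [^] i) <# A)"

lemma cyc_ext_iff: "u \<in> cyc_ext x A \<longleftrightarrow> (\<exists>i::int. u \<in> (x [^] i) <# A)"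
  unfolding cyc_ext_def by blast

lemma cyc_extI: "a \<in> A \<Longrightarrow> x [^] (i::int) \<otimes> a \<in> cyc_ext x A"
  unfolding cyc_ext_def l_coset_def by blast

lemma cyc_extE:
  assumes "u \<in> cyc_ext x A"
  obtains i :: int and a where "a \<in> A" "u = x [^] i \<otimes> a"
  using assms unfolding cyc_ext_def l_coset_def by blast

lemma cyc_ext_closed: "\<lbrakk>x \<in> carrier G; A \<subseteq> carrier G; u \<in> cyc_ext x A\<rbrakk> \<Longrightarrow> u \<in> carrier G"
  by (auto elim: cyc_extE)

lemma subset_cyc_ext:
  assumes "A \<subseteq> carrier G" shows "A \<subseteq> cyc_ext x A"
proof
  fix a assume "a \<in> A"
  then show "a \<in> cyc_ext x A" using cyc_extI[of a A x 0] assms by auto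
qed

text \<open>Chains from \<open>B\<close> up to \<open>A\<close> with cyclic factors, in which a
  member must be normal in the whole group to be extended. The variable bottom allows chains to be
  concatenated and torsion to be measured relative to \<open>B\<close>.\<close>

inductive polycyclic_over :: "'a set \<Rightarrow> 'a set \<Rightarrow> bool" for B where
  base: "polycyclic_over B B"
| step: "\<lbrakk>polycyclic_over B A; A \<lhd> G; x \<in> carrier G\<rbrakk> \<Longrightarrow> polycyclic_over B (cyc_ext x A)"

lemma l_coset_pow_zero: "A \<subseteq> carrier G \<Longrightarrow> (x [^] (0::int)) <# A = A"
  by (simp add: lcos_mult_one)

lemma coset_mult_closed:
  assumes "A \<lhd> G" "x \<in> carrier G" "u \<in> (x [^] (i::int)) <# A" "v \<in> (x [^] (j::int)) <# A"
  shows "u \<otimes> v \<in> (x [^] (i + j)) <# A"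
proof -
  interpret A: normal A G by fact
  obtain a b where *: "a \<in> A" "b \<in> A" "u = x [^] i \<otimes> a" "v = x [^] j \<otimes> b"
    using assms unfolding l_coset_def by blast
  let ?y = "x [^] j"
  have y: "?y \<in> carrier G" using assms by simp
  have "inv ?y \<otimes> a \<otimes> ?y \<in> A" using A.inv_op_closed1[OF y *(1)] .
  then have "inv ?y \<otimes> a \<otimes> ?y \<otimes> b \<in> A" using *(2) by blast
  moreover have "u \<otimes> v = x [^] (i + j) \<otimes> (inv ?y \<otimes> a \<otimes> ?y \<otimes> b)"
    using * y assms(2) A.mem_carrier[OF *(1)] A.mem_carrier[OF *(2)]
    by (simp add: int_pow_mult m_assoc)
  ultimately show ?thesis unfolding l_coset_def by blast
qed

lemma coset_inv_closed:
  assumes "A \<lhd> G" "x \<in> carrier G" "u \<in> (x [^] (i::int)) <# A"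
  shows "inv u \<in> (x [^] (- i)) <# A"
proof -
  interpret A: normal A G by fact
  obtain a where *: "a \<in> A" "u = x [^] i \<otimes> a"
    using assms unfolding l_coset_def by blast
  let ?y = "x [^] i"
  have y: "?y \<in> carrier G" using assms by simp
  have "?y \<otimes> inv a \<otimes> inv ?y \<in> A" using A.inv_op_closed2[OF y, of "inv a"] *(1) by simp
  moreover have "inv u = x [^] (- i) \<otimes> (?y \<otimes> inv a \<otimes> inv ?y)"
    using * y assms(2) A.mem_carrier[OF *(1)]
    by (simp add: int_pow_neg inv_mult_group m_assoc)
  ultimately show ?thesis unfolding l_coset_def by blast
qed

lemma coset_int_pow_closed:
  assumes "A \<lhd> G" "x \<in> carrier G" "u \<in> (x [^] (i::int)) <# A"
  shows "u [^] (k::int) \<in> (x [^] (i * k)) <# A"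
proof -
  interpret A: normal A G by fact
  have u: "u \<in> carrier G" using assms(2,3) unfolding l_coset_def by auto
  have nat: "u [^] n \<in> (x [^] (i * int n)) <# A" for n :: nat
  proof (induction n)
    case 0
    then show ?case unfolding l_coset_def by (auto intro: bexI[of _ \<one>])
  next
    case (Suc n)
    then show ?case
      using coset_mult_closed[OF assms(1,2) Suc assms(3)] by (simp add: algebra_simps)
  qed
  show ?thesis
  proof (cases k rule: int_cases)
    case (nonneg n)
    then show ?thesis using nat[of n] by (simp add: int_pow_int)
  next
    case (neg n)
    then show ?thesis
      using coset_inv_closed[OF assms(1,2) nat[of "Suc n"]] u
      by (simp add: int_pow_neg_int del: of_nat_Suc nat_pow_Suc)
  qed
qed

lemma subgroup_cyc_ext:
  assumes "A \<lhd> G" "x \<in> carrier G"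
  shows "subgroup (cyc_ext x A) G"
proof (rule subgroupI)
  interpret A: normal A G by fact
  show "cyc_ext x A \<subseteq> carrier G" using cyc_ext_closed[OF assms(2) A.subset] by blast
  show "cyc_ext x A \<noteq> {}" using subset_cyc_ext[OF A.subset] A.one_closed by blast
  show "inv u \<in> cyc_ext x A" if "u \<in> cyc_ext x A" for u
    using that coset_inv_closed[OF assms] unfolding cyc_ext_iff by blast
  show "u \<otimes> v \<in> cyc_ext x A" if "u \<in> cyc_ext x A" "v \<in> cyc_ext x A" for u v
    using that coset_mult_closed[OF assms] unfolding cyc_ext_iff by blast
qed

lemma generate_insert_normal:
  assumes "A \<lhd> G" "x \<in> carrier G"
  shows "generate G (insert x A) = cyc_ext x A"
proof (rule equalityI)
  interpret A: normal A G by fact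
  have "x \<in> cyc_ext x A" using cyc_extI[OF A.one_closed, of x 1] assms(2) by simp
  then have "insert x A \<subseteq> cyc_ext x A" using subset_cyc_ext[OF A.subset] by blast
  then show "generate G (insert x A) \<subseteq> cyc_ext x A"
    using generate_subgroup_incl subgroup_cyc_ext[OF assms] by blast
  have sub: "subgroup (generate G (insert x A)) G"
    using assms(2) A.subset by (intro generate_is_subgroup) auto
  show "cyc_ext x A \<subseteq> generate G (insert x A)"
  proof
    fix u assume "u \<in> cyc_ext x A"
    then obtain i :: int and a where "a \<in> A" "u = x [^] i \<otimes> a" by (rule cyc_extE)
    then show "u \<in> generate G (insert x A)"
      using subgroup.m_closed[OF sub subgroup_int_pow_closed[OF sub]] by (simp add: generate.incl)
  qed
qed

lemma generate_eq_subgroup: "subgroup K G \<Longrightarrow> generate G K = K"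
  by (intro equalityI generate_subgroup_incl) (auto intro: generate.incl)

text \<open>The elements of \<open>S\<close> are adjoined one at a time; the members of the chain
  are then generated by \<open>B\<close> and subsets of \<open>S\<close>, whose normality the last
  hypothesis asks for.\<close>

lemma polycyclic_over_generate:
  assumes "finite S" "S \<subseteq> carrier G" "subgroup B G"
    and normal: "\<And>T. T \<subseteq> S \<Longrightarrow> generate G (B \<union> T) \<lhd> G"
  shows "polycyclic_over B (generate G (B \<union> S))"
  using assms(1,2) normal
proof (induction S)
  case empty
  then show ?case using generate_eq_subgroup[OF assms(3)] by (simp add: polycyclic_over.base)
next
  case (insert s S)
  let ?A = "generate G (B \<union> S)"
  have A: "?A \<lhd> G" using insert.prems by blast
  have s: "s \<in> carrier G" and sub: "B \<union> S \<subseteq> carrier G"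
    using insert.prems assms(3) subgroup.subset by auto
  have "generate G (B \<union> insert s S) = generate G (insert s ?A)"
  proof (rule equalityI)
    have "B \<union> insert s S \<subseteq> insert s ?A" by (auto intro: generate.incl)
    then show "generate G (B \<union> insert s S) \<subseteq> generate G (insert s ?A)" by (rule mono_generate)
    have "insert s ?A \<subseteq> generate G (B \<union> insert s S)"
      using mono_generate[of "B \<union> S" "B \<union> insert s S"] by (auto intro: generate.incl)
    then show "generate G (insert s ?A) \<subseteq> generate G (B \<union> insert s S)"
      using s sub by (intro generate_subgroup_incl generate_is_subgroup) auto
  qed
  moreover have "polycyclic_over B ?A"
    using insert.prems by (intro insert.IH) auto
  ultimately show ?case
    using generate_insert_normal[OF A s] polycyclic_over.step[OF _ A s] by simp
qed

text \<open>The exponents i for which \<open>C\<close> meets x^i A form a subgroup of the integers.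
  Generators of the intersection of \<open>C\<close> and \<open>A\<close>, together with one element
  of \<open>C\<close> over the least positive exponent, generate \<open>C\<close>.\<close>

lemma polycyclic_subgroup_fg:
  assumes "polycyclic_over {\<one>} A" "subgroup C G" "C \<subseteq> A"
  shows "\<exists>T. finite T \<and> T \<subseteq> C \<and> generate G T = C"
  using assms
proof (induction arbitrary: C)
  case base
  then have "C = {\<one>}" using subgroup.one_closed by blast
  then show ?case using generate_empty by (intro exI[of _ "{}"]) auto
next
  case (step A x)
  interpret A: normal A G by fact
  interpret C: subgroup C G by fact
  have sub: "subgroup (C \<inter> A) G"
    using subgroups_Inter_pair[OF step.prems(1) A.subgroup_axioms] .
  then obtain T where T: "finite T" "T \<subseteq> C \<inter> A" "generate G T = C \<inter> A"
    using step.IH[of "C \<inter> A"] by blast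
  define I where "I = {i::int. C \<inter> ((x [^] i) <# A) \<noteq> {}}"
  have C_in: "\<exists>i\<in>I. c \<in> (x [^] i) <# A" if "c \<in> C" for c
    using that step.prems(2) cyc_ext_iff[of c x A] unfolding I_def by blast
  have zero: "(x [^] (0::int)) <# A = A" by (rule l_coset_pow_zero[OF A.subset])
  show ?case
  proof (cases "\<exists>d>0. d \<in> I")
    case False
    \<comment> \<open>A negative exponent would give a positive one by inversion, so here
      \<open>C\<close> lies in \<open>A\<close>.\<close>
    have "i = 0" if "i \<in> I" for i
    proof -
      from that obtain c where "c \<in> C" "c \<in> (x [^] i) <# A" unfolding I_def by blast
      then have "- i \<in> I" using coset_inv_closed[OF step.hyps(2,3), of c i] unfolding I_def by blast
      then show ?thesis using False that by (meson neg_0_less_iff_less not_less_iff_gr_or_eq)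
    qed
    then have "C \<inter> A = C" using C_in zero by blast
    then show ?thesis using T by auto
  next
    case True
    then have ex: "\<exists>n::nat. 0 < n \<and> int n \<in> I" by (metis pos_int_cases of_nat_0_less_iff)
    define d where "d = (LEAST n::nat. 0 < n \<and> int n \<in> I)"
    have d: "0 < d" "int d \<in> I" using LeastI_ex[OF ex] unfolding d_def by auto
    have least: "\<not> (0 < n \<and> int n \<in> I)" if "n < d" for n
      using not_less_Least[of n "\<lambda>n. 0 < n \<and> int n \<in> I"] that unfolding d_def by blast
    from d obtain b where b: "b \<in> C" "b \<in> (x [^] int d) <# A" unfolding I_def by blast
    have subc: "insert b T \<subseteq> C" using b T by blast
    have "C \<subseteq> generate G (insert b T)"
    proof
      fix c assume c: "c \<in> C"
      then obtain i :: int where i: "c \<in> (x [^] i) <# A" using C_in by blast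
      define k where "k = i div int d"
      \<comment> \<open>Division with remainder: removing a power of b leaves an element of
        \<open>C\<close> over i mod d, and minimality of d forces this exponent to be 0.\<close>
      let ?c = "c \<otimes> b [^] (- k)"
      have bk: "b [^] j \<in> C" for j :: int
        using subgroup_int_pow_closed[OF C.subgroup_axioms b(1)] .
      have "?c \<in> (x [^] (i + int d * (- k))) <# A"
        by (rule coset_mult_closed[OF step.hyps(2,3) i coset_int_pow_closed[OF step.hyps(2,3) b(2)]])
      moreover have "i + int d * (- k) = i mod int d"
        unfolding k_def by (simp add: minus_mult_div_eq_mod)
      ultimately have r: "?c \<in> (x [^] (i mod int d)) <# A" by simp
      have "?c \<in> C" using c bk by blast
      then have "i mod int d \<in> I" using r unfolding I_def by blast
      moreover have "0 \<le> i mod int d" "i mod int d < int d" using d by auto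
      ultimately have "i mod int d = 0"
        using least[of "nat (i mod int d)"] by fastforce
      then have "?c \<in> generate G T" using r zero \<open>?c \<in> C\<close> T(3) by simp
      then have "?c \<in> generate G (insert b T)" using mono_generate[of T "insert b T"] by blast
      moreover have gs: "subgroup (generate G (insert b T)) G"
        using subc C.subset by (intro generate_is_subgroup) auto
      have "b [^] k \<in> generate G (insert b T)"
        using subgroup_int_pow_closed[OF gs] by (simp add: generate.incl)
      ultimately have "?c \<otimes> b [^] k \<in> generate G (insert b T)" by (rule generate.eng)
      moreover have "?c \<otimes> b [^] k = c"
        using c b(1) by (simp add: m_assoc int_pow_mult[symmetric])
      ultimately show "c \<in> generate G (insert b T)" by simp
    qed
    moreover have "generate G (insert b T) \<subseteq> C"
      using subc generate_subgroup_incl C.subgroup_axioms by blast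
    ultimately show ?thesis using T subc by (intro exI[of _ "insert b T"]) auto
  qed
qed

text \<open>Modulo \<open>N\<close> the exponent of x matters only modulo q, so q times as many
  representatives suffice after each extension; normality of \<open>N\<close> moves leftover factors
  to the left past the power of x.\<close>

lemma polycyclic_finite_reps:
  fixes q :: nat
  assumes "polycyclic_over {\<one>} A" "N \<lhd> G" "q > 0" and pow: "\<And>x. x \<in> carrier G \<Longrightarrow> x [^] q \<in> N"
  shows "\<exists>R. finite R \<and> R \<subseteq> carrier G \<and> A \<subseteq> (\<Union>r\<in>R. N #> r)"
  using assms(1)
proof induction
  interpret N: normal N G by fact
  case base
  then show ?case by (intro exI[of _ "{\<one>}"]) (auto simp: N.subset)
next
  case (step A x)
  interpret N: normal N G by fact
  obtain R where R: "finite R" "R \<subseteq> carrier G" "A \<subseteq> (\<Union>r\<in>R. N #> r)" using step.IH by blast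
  define R' where "R' = (\<lambda>(i :: nat, r). x [^] i \<otimes> r) ` ({..<q} \<times> R)"
  have "finite R'" "R' \<subseteq> carrier G" using R step.hyps unfolding R'_def by auto
  moreover have "cyc_ext x A \<subseteq> (\<Union>r\<in>R'. N #> r)"
  proof
    fix u assume "u \<in> cyc_ext x A"
    then obtain i :: int and a where u: "a \<in> A" "u = x [^] i \<otimes> a" by (rule cyc_extE)
    then obtain r n where r: "r \<in> R" "n \<in> N" "a = n \<otimes> r"
      using R(3) u(1) unfolding r_coset_def by blast
    define l where "l = nat (i mod int q)"
    have l: "l < q" "int l = i mod int q" unfolding l_def using assms(3) by (auto simp: nat_less_iff)
    have "x [^] i = (x [^] q) [^] (i div int q) \<otimes> x [^] l"
    proof -
      have "(x [^] q) [^] (i div int q) \<otimes> x [^] l = x [^] (int q * (i div int q)) \<otimes> x [^] int l"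
        using step.hyps by (simp add: int_pow_pow[symmetric] int_pow_int)
      also have "\<dots> = x [^] i" using step.hyps l by (simp add: int_pow_mult[symmetric])
      finally show ?thesis by simp
    qed
    moreover define p where "p = (x [^] q) [^] (i div int q)"
    ultimately have xi: "x [^] i = p \<otimes> x [^] l" by simp
    have p: "p \<in> N" unfolding p_def
      using subgroup_int_pow_closed[OF N.subgroup_axioms pow[OF step.hyps(3)]] .
    let ?y = "x [^] l"
    have y: "?y \<in> carrier G" using step.hyps by simp
    have "?y \<otimes> n \<otimes> inv ?y \<in> N" using N.inv_op_closed2[OF y r(2)] .
    then have "p \<otimes> (?y \<otimes> n \<otimes> inv ?y) \<in> N" using p by blast
    moreover have "u = p \<otimes> (?y \<otimes> n \<otimes> inv ?y) \<otimes> (?y \<otimes> r)"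
      using u(2) r xi y N.mem_carrier[OF p] N.mem_carrier[OF r(2)] R(2) by (auto simp: m_assoc subset_iff)
    moreover have "?y \<otimes> r \<in> R'" using r l unfolding R'_def by force
    ultimately show "u \<in> (\<Union>r\<in>R'. N #> r)" unfolding r_coset_def by blast
  qed
  ultimately show ?case by blast
qed

lemma polycyclic_over_subset: "polycyclic_over B A \<Longrightarrow> B \<subseteq> A"
proof (induction rule: polycyclic_over.induct)
  case (step A x)
  then show ?case
    using subset_cyc_ext[OF subgroup.subset[OF normal_imp_subgroup[OF step.hyps(2)]], of x] by blast
qed simp

text \<open>If x^m lies in \<open>A\<close> for some positive m, then m-th powers of the extension
  lie in \<open>A\<close> and m e serves. Otherwise an element x^i a that is torsion modulo
  \<open>B\<close> has i = 0, so e is kept. With \<open>B\<close> trivial this bounds the torsion of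
  the group; with \<open>B\<close> the derived subgroup it bounds the exponent of
  \<open>tau G\<close> over it.\<close>

lemma polycyclic_bounded_torsion:
  assumes "polycyclic_over B A" "subgroup B G"
  shows "\<exists>e>0. \<forall>z\<in>A. (\<exists>k::nat. k > 0 \<and> z [^] k \<in> B) \<longrightarrow> z [^] (e::nat) \<in> B"
  using assms(1)
proof induction
  case base
  then show ?case using subgroup.subset[OF assms(2)] by (intro exI[of _ 1]) auto
next
  case (step A x)
  interpret A: normal A G by fact
  have BA: "B \<subseteq> A" by (rule polycyclic_over_subset[OF step.hyps(1)])
  have zero: "(x [^] (0::int)) <# A = A" by (rule l_coset_pow_zero[OF A.subset])
  obtain e :: nat where e: "e > 0" "\<forall>z\<in>A. (\<exists>k::nat. k > 0 \<and> z [^] k \<in> B) \<longrightarrow> z [^] e \<in> B"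
    using step.IH by blast
  show ?case
  proof (cases "\<exists>m::nat. m > 0 \<and> x [^] m \<in> A")
    case True
    then obtain m :: nat where m: "m > 0" "x [^] m \<in> A" by blast
    have "z [^] (m * e) \<in> B" if z: "z \<in> cyc_ext x A" and k: "k > 0" "z [^] k \<in> B" for z and k :: nat
    proof -
      obtain i :: int where i: "z \<in> (x [^] i) <# A" using z cyc_ext_iff by blast
      have zc: "z \<in> carrier G" using cyc_ext_closed[OF step.hyps(3) A.subset z] .
      have "z [^] int m \<in> (x [^] (i * int m)) <# A"
        by (rule coset_int_pow_closed[OF step.hyps(2,3) i])
      moreover have "x [^] (i * int m) = (x [^] m) [^] i"
        using step.hyps(3) by (simp add: int_pow_pow mult.commute flip: int_pow_int)
      moreover have "(x [^] m) [^] i \<in> A" using subgroup_int_pow_closed[OF A.subgroup_axioms m(2)] .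
      ultimately have zm: "z [^] m \<in> A" unfolding l_coset_def by (auto simp: int_pow_int)
      have "(z [^] m) [^] k = (z [^] k) [^] m" using zc by (simp add: nat_pow_pow mult.commute)
      also have "\<dots> \<in> B" using subgroup_nat_pow_closed[OF assms(2) k(2)] .
      finally have "(z [^] m) [^] e \<in> B" using e zm k by blast
      then show ?thesis using zc by (simp add: nat_pow_pow)
    qed
    then show ?thesis using e m by (intro exI[of _ "m * e"]) auto
  next
    case False
    have "z [^] e \<in> B" if z: "z \<in> cyc_ext x A" and k: "k > 0" "z [^] k \<in> B" for z and k :: nat
    proof -
      obtain i :: int where i: "z \<in> (x [^] i) <# A" using z cyc_ext_iff by blast
      have "z [^] int k \<in> (x [^] (i * int k)) <# A"
        by (rule coset_int_pow_closed[OF step.hyps(2,3) i])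
      then obtain a where a: "a \<in> A" "z [^] k = x [^] (i * int k) \<otimes> a"
        unfolding l_coset_def by (auto simp: int_pow_int)
      then have "x [^] (i * int k) = z [^] k \<otimes> inv a"
        using step.hyps(3) A.mem_carrier[OF a(1)] by (simp add: m_assoc)
      then have xik: "x [^] (i * int k) \<in> A" using a(1) k(2) BA by auto
      then have "inv (x [^] (i * int k)) \<in> A" by simp
      then have "x [^] nat \<bar>i * int k\<bar> \<in> A"
        using xik step.hyps(3) by (auto simp: abs_if int_pow_neg pow_nat)
      with False have "\<not> nat \<bar>i * int k\<bar> > 0" by metis
      then have "i = 0" using k by simp
      then have "z \<in> A" using i zero by simp
      then show ?thesis using e k by blast
    qed
    then show ?thesis using e by blast
  qed
qed

end

section \<open>Finitely generated groups of class two\<close>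

context group
begin

lemma polycyclic_over_trans: "polycyclic_over A C \<Longrightarrow> polycyclic_over B A \<Longrightarrow> polycyclic_over B C"
  by (induction rule: polycyclic_over.induct) (auto intro: polycyclic_over.step)

lemma finite_rcosets_reps:
  assumes "N \<lhd> G" "finite R" "R \<subseteq> carrier G" "carrier G \<subseteq> (\<Union>r\<in>R. N #> r)"
  shows "finite (rcosets N)"
proof -
  have N: "subgroup N G" using assms(1) by (rule normal_imp_subgroup)
  have "rcosets N \<subseteq> (\<lambda>r. N #> r) ` R"
  proof
    fix Y assume "Y \<in> rcosets N"
    then obtain x where x: "x \<in> carrier G" "Y = N #> x" unfolding RCOSETS_def by blast
    then obtain r where "r \<in> R" "x \<in> N #> r" using assms(4) by blast
    then show "Y \<in> (\<lambda>r. N #> r) ` R" using repr_independence[OF _ _ N] x(2) assms(3) by blast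
  qed
  then show ?thesis using assms(2) finite_surj by blast
qed

lemma torsion_free_int_powD:
  assumes "torsion_free G" "x \<in> carrier G" "x [^] (i::int) = \<one>" "i \<noteq> 0"
  shows "x = \<one>"
proof -
  have "x [^] nat \<bar>i\<bar> = \<one>"
    using assms(2,3) by (auto simp: abs_if pow_nat int_pow_neg)
  moreover have "nat \<bar>i\<bar> > 0" using assms(4) by simp
  ultimately show ?thesis using assms(1,2) unfolding torsion_free_def by blast
qed

text \<open>The derived subgroup is closed under inverses, so s may be replaced by its absolute
  value; positive natural exponents are the form used in
  \<open>polycyclic_bounded_torsion\<close>.\<close>

lemma tau_iff_nat: "x \<in> tau G \<longleftrightarrow> x \<in> carrier G \<and> (\<exists>k::nat. k > 0 \<and> x [^] k \<in> derived G (carrier G))"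
proof -
  have D: "subgroup (derived G (carrier G)) G" by (rule derived_is_subgroup) simp
  show ?thesis
  proof (intro iffI conjI)
    assume x: "x \<in> tau G"
    then show xc: "x \<in> carrier G" unfolding tau_def by blast
    from x obtain s :: int where s: "s \<noteq> 0" "x [^] s \<in> derived G (carrier G)"
      unfolding tau_def by blast
    then have "x [^] \<bar>s\<bar> \<in> derived G (carrier G)"
      using xc subgroup.m_inv_closed[OF D] by (auto simp: abs_if int_pow_neg)
    then have "x [^] nat \<bar>s\<bar> \<in> derived G (carrier G)" by (simp add: pow_nat)
    then show "\<exists>k::nat. k > 0 \<and> x [^] k \<in> derived G (carrier G)"
      using s(1) by (intro exI[of _ "nat \<bar>s\<bar>"]) auto
  next
    assume "x \<in> carrier G \<and> (\<exists>k::nat. k > 0 \<and> x [^] k \<in> derived G (carrier G))"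
    then obtain k :: nat where "x \<in> carrier G" "k > 0" "x [^] int k \<in> derived G (carrier G)"
      by (auto simp: int_pow_int)
    then show "x \<in> tau G" unfolding tau_def by (auto intro!: exI[of _ "int k"])
  qed
qed

lemma derived_subset_tau: "derived G (carrier G) \<subseteq> tau G"
proof
  fix x assume x: "x \<in> derived G (carrier G)"
  then have "x \<in> carrier G" using derived_in_carrier by blast
  then show "x \<in> tau G" unfolding tau_iff_nat using x by (intro conjI exI[of _ 1]) auto
qed

lemma pow_tau_imp_tau:
  assumes "x \<in> carrier G" "x [^] (k::nat) \<in> tau G" "k > 0"
  shows "x \<in> tau G"
proof -
  obtain m :: nat where "m > 0" "(x [^] k) [^] m \<in> derived G (carrier G)"
    using assms(2) unfolding tau_iff_nat by blast
  then show ?thesis using assms unfolding tau_iff_nat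
    by (auto simp: nat_pow_pow intro!: exI[of _ "k * m"])
qed

end

context class_two_group
begin

text \<open>Commutators are multiplicative in the first argument and inversion exchanges the
  arguments, so both reduce to generators. For finite \<open>S\<close> this makes the derived
  subgroup generated by finitely many central elements.\<close>

lemma derived_eq_generators:
  assumes S: "S \<subseteq> carrier G" "generate G S = carrier G"
  shows "derived G (carrier G) = generate G {comm G s t | s t. s \<in> S \<and> t \<in> S}" (is "_ = ?C")
proof (rule equalityI)
  let ?X = "{comm G s t | s t. s \<in> S \<and> t \<in> S}"
  have X: "?X \<subseteq> carrier G" using S by auto
  have C: "subgroup ?C G" by (rule generate_is_subgroup[OF X])
  have left: "\<forall>t\<in>S. comm G x t \<in> ?C" if "x \<in> generate G S" for x
    using that
  proof induction
    case one
    then show ?case using S generate.one by (auto simp: subset_iff)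
  next
    case (incl h)
    then show ?case by (auto intro: generate.incl)
  next
    case (inv h)
    show ?case
    proof
      fix t assume t: "t \<in> S"
      have cl: "h \<in> carrier G" "t \<in> carrier G" using S inv t by auto
      have "comm G (inv h) t \<otimes> comm G h t = \<one>"
        using comm_mult_left[of "inv h" h t] cl by simp
      then have "comm G (inv h) t = inv (comm G h t)" using cl by (simp add: inv_equality)
      moreover have "comm G h t \<in> ?C" using inv t by (intro generate.incl) blast
      ultimately show "comm G (inv h) t \<in> ?C" using subgroup.m_inv_closed[OF C, of "comm G h t"] by simp
    qed
  next
    case (eng a b)
    show ?case
    proof
      fix t assume t: "t \<in> S"
      have "a \<in> carrier G" "b \<in> carrier G" "t \<in> carrier G"
        using S eng t by auto
      note eq = comm_mult_left[OF this]
      show "comm G (a \<otimes> b) t \<in> ?C"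
        unfolding eq by (rule generate.eng) (use eng.IH t in blast)+
    qed
  qed
  \<comment> \<open>Again an induction on the first argument, now against all x; the generators are
    covered by \<open>left\<close> after exchanging the arguments.\<close>
  have right: "\<forall>x\<in>carrier G. comm G y x \<in> ?C" if "y \<in> generate G S" for y
    using that
  proof induction
    case one
    then show ?case using generate.one by auto
  next
    case (incl h)
    show ?case
    proof
      fix x assume x: "x \<in> carrier G"
      then have "comm G x h \<in> ?C" using left incl S by blast
      then have "inv (comm G x h) \<in> ?C" by (rule subgroup.m_inv_closed[OF C])
      moreover have "h \<in> carrier G" using incl S by blast
      note inv_comm[OF x this]
      ultimately show "comm G h x \<in> ?C" by simp
    qed
  next
    case (inv h)
    show ?case
    proof
      fix x assume x: "x \<in> carrier G"
      have h: "h \<in> carrier G" using S inv by auto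
      have "comm G (inv h) x \<otimes> comm G h x = \<one>"
        using comm_mult_left[of "inv h" h x] h x by simp
      then have "comm G (inv h) x = inv (comm G h x)" using h x by (simp add: inv_equality)
      also have "\<dots> = comm G x h" using inv_comm[OF h x] .
      finally show "comm G (inv h) x \<in> ?C" using left x inv S by simp
    qed
  next
    case (eng a b)
    show ?case
    proof
      fix x assume x: "x \<in> carrier G"
      have "a \<in> carrier G" "b \<in> carrier G" using S eng by auto
      note eq = comm_mult_left[OF this x]
      show "comm G (a \<otimes> b) x \<in> ?C"
        unfolding eq by (rule generate.eng) (use eng.IH x in blast)+
    qed
  qed
  show "derived G (carrier G) \<subseteq> ?C"
    unfolding derived_def by (rule generate_subgroup_incl[OF _ C]) (use right S in auto)
  show "?C \<subseteq> derived G (carrier G)"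
    unfolding derived_def by (rule mono_generate) (use S in auto)
qed

end

locale fg_class_two_group = class_two_group +
  assumes fg: "finitely_generated G"
begin

text \<open>The two halves of the chain are normal for different reasons: subgroups generated by
  commutators are central, and a subgroup containing the derived subgroup is normal since x h x^{-1}
  = [x,h] h.\<close>

lemma polycyclic_derived: "polycyclic_over {\<one>} (derived G (carrier G))"
  and polycyclic_over_derived: "polycyclic_over (derived G (carrier G)) (carrier G)"
proof -
  obtain S where S: "finite S" "S \<subseteq> carrier G" "generate G S = carrier G"
    using fg unfolding finitely_generated_def by blast
  let ?X = "{comm G s t | s t. s \<in> S \<and> t \<in> S}"
  have "?X \<subseteq> (\<lambda>(s, t). comm G s t) ` (S \<times> S)" by auto
  then have fX: "finite ?X" using S(1) by (meson finite_SigmaI finite_surj)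
  have X: "?X \<subseteq> carrier G" using S by auto
  have Xc: "?X \<subseteq> center G" using S comm_central by blast
  have "polycyclic_over {\<one>} (generate G ({\<one>} \<union> ?X))"
  proof (rule polycyclic_over_generate[OF fX X])
    show "subgroup {\<one>} G" by (rule triv_subgroup)
    fix T assume "T \<subseteq> ?X"
    then have T: "{\<one>} \<union> T \<subseteq> center G" using Xc subgroup.one_closed[OF subgroup_center] by blast
    show "generate G ({\<one>} \<union> T) \<lhd> G"
    proof (rule subgroup_central_imp_normal)
      show "subgroup (generate G ({\<one>} \<union> T)) G"
        using T unfolding center_def by (intro generate_is_subgroup) auto
      show "generate G ({\<one>} \<union> T) \<subseteq> center G" by (rule generate_subgroup_incl[OF T subgroup_center])
    qed
  qed
  moreover have "generate G ({\<one>} \<union> ?X) = generate G ?X"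
  proof (rule equalityI)
    have "{\<one>} \<union> ?X \<subseteq> generate G ?X"
      using generate.one[of G ?X] generate.incl[of _ ?X G] by blast
    then show "generate G ({\<one>} \<union> ?X) \<subseteq> generate G ?X"
      using generate_subgroup_incl generate_is_subgroup[OF X] by blast
    show "generate G ?X \<subseteq> generate G ({\<one>} \<union> ?X)" by (rule mono_generate) blast
  qed
  ultimately show "polycyclic_over {\<one>} (derived G (carrier G))"
    using derived_eq_generators[OF S(2,3)] by simp
  have D: "derived G (carrier G) \<subseteq> carrier G" by (rule derived_in_carrier) simp
  have "polycyclic_over (derived G (carrier G)) (generate G (derived G (carrier G) \<union> S))"
  proof (rule polycyclic_over_generate[OF S(1,2)])
    show "subgroup (derived G (carrier G)) G" by (rule derived_is_subgroup) simp
    fix T assume T: "T \<subseteq> S"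
    show "generate G (derived G (carrier G) \<union> T) \<lhd> G"
    proof (rule subgroup_derived_imp_normal)
      show "subgroup (generate G (derived G (carrier G) \<union> T)) G"
        using T S D by (intro generate_is_subgroup) auto
    qed (auto intro: generate.incl)
  qed
  moreover have "generate G (derived G (carrier G) \<union> S) = carrier G"
    using mono_generate[of S "derived G (carrier G) \<union> S"] generate_incl[of "derived G (carrier G) \<union> S"] S D
    by auto
  ultimately show "polycyclic_over (derived G (carrier G)) (carrier G)" by simp
qed

lemma polycyclic: "polycyclic_over {\<one>} (carrier G)"
  using polycyclic_over_trans[OF polycyclic_over_derived polycyclic_derived] .

lemma finite_rcosets_exponent:
  assumes "N \<lhd> G" "q > (0::nat)" "\<And>x. x \<in> carrier G \<Longrightarrow> x [^] q \<in> N"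
  shows "finite (rcosets N)"
proof -
  obtain R where "finite R" "R \<subseteq> carrier G" "carrier G \<subseteq> (\<Union>r\<in>R. N #> r)"
    using polycyclic_finite_reps[OF polycyclic assms] by blast
  then show ?thesis by (rule finite_rcosets_reps[OF assms(1)])
qed

lemma bounded_torsion:
  obtains e :: nat where "e > 0" "\<And>z k. \<lbrakk>z \<in> carrier G; k > (0::nat); z [^] k = \<one>\<rbrakk> \<Longrightarrow> z [^] e = \<one>"
  using polycyclic_bounded_torsion[OF polycyclic triv_subgroup] by blast

lemma tau_exponent:
  obtains e :: nat where "e > 0" "\<And>z. z \<in> tau G \<Longrightarrow> z [^] e \<in> derived G (carrier G)"
  using polycyclic_bounded_torsion[OF polycyclic_over_derived derived_is_subgroup[OF subset_refl]]
  unfolding tau_iff_nat by blast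

text \<open>The exponent 2e works if e kills all torsion: an element t of that power subgroup is
  some z^e, and z is torsion along with t, so t would be trivial.\<close>

lemma exists_power_subgroup_avoiding_torsion:
  assumes "t \<in> carrier G" "t \<noteq> \<one>" "t [^] (r::nat) = \<one>" "r > 0"
  obtains s :: nat where "s > 0" "t \<notin> power_subgroup G s"
proof -
  obtain e :: nat where e: "e > 0" "\<And>z k. \<lbrakk>z \<in> carrier G; k > (0::nat); z [^] k = \<one>\<rbrakk> \<Longrightarrow> z [^] e = \<one>"
    using bounded_torsion by blast
  have "t \<notin> power_subgroup G (2 * e)"
  proof
    assume "t \<in> power_subgroup G (2 * e)"
    then obtain z where z: "z \<in> carrier G" "t = z [^] e" by (rule power_subgroup_even)
    then have "z [^] (e * r) = \<one>" using assms(3) by (simp add: nat_pow_pow)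
    then have "z [^] e = \<one>" using e z assms(4) by (metis nat_0_less_mult_iff)
    then show False using z assms(2) by simp
  qed
  then show thesis using that[of "2 * e"] e by simp
qed

end

section \<open>The isolator and unique roots in the torsion-free case\<close>

locale tf_class_two_group = fg_class_two_group +
  assumes tf: "torsion_free G"
begin

text \<open>If z^k is central then [z,x]^k = [z^k,x] = 1, and torsion-freeness makes [z,x]
  trivial.\<close>

lemma tau_central: "tau G \<subseteq> center G"
proof
  fix z assume "z \<in> tau G"
  then obtain k :: nat where z: "z \<in> carrier G" and k: "k > 0" "z [^] k \<in> derived G (carrier G)"
    unfolding tau_iff_nat by blast
  have "z \<otimes> x = x \<otimes> z" if x: "x \<in> carrier G" for x
  proof -
    have zk: "z [^] k \<in> center G" using k derived_central by blast
    have "comm G z x [^] k = comm G (z [^] k) x" using comm_pow_left z x by simp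
    also have "\<dots> = \<one>"
    proof -
      have "z [^] k \<otimes> x = x \<otimes> z [^] k" using zk x unfolding center_def by blast
      then have "comm G (z [^] k) x = x \<otimes> z [^] k \<otimes> inv (z [^] k) \<otimes> inv x" by simp
      then show ?thesis using x z by (simp add: m_assoc)
    qed
    finally have "comm G z x = \<one>"
      using tf k(1) x z unfolding torsion_free_def by blast
    then show ?thesis using mult_eq_comm_mult[of z x] x z by simp
  qed
  then show "z \<in> center G" using z unfolding center_def by blast
qed

lemma subgroup_tau: "subgroup (tau G) G"
proof (rule subgroupI)
  have D: "subgroup (derived G (carrier G)) G" by (rule derived_is_subgroup) simp
  show "tau G \<subseteq> carrier G" unfolding tau_def by blast
  show "tau G \<noteq> {}" using subgroup.one_closed[OF D] derived_subset_tau by blast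
  show "inv a \<in> tau G" if "a \<in> tau G" for a
    using that subgroup.m_inv_closed[OF D] unfolding tau_iff_nat by (auto simp: nat_pow_inv)
  fix a b assume a: "a \<in> tau G" and b: "b \<in> tau G"
  obtain k l :: nat where kl: "k > 0" "l > 0" "a [^] k \<in> derived G (carrier G)" "b [^] l \<in> derived G (carrier G)"
    "a \<in> carrier G" "b \<in> carrier G"
    using a b unfolding tau_iff_nat by blast
  have "(a \<otimes> b) [^] (k * l) = (a [^] k) [^] l \<otimes> (b [^] l) [^] k"
    using center_pow_mult[of a b "k * l"] kl b tau_central by (auto simp: nat_pow_pow mult.commute)
  also have "\<dots> \<in> derived G (carrier G)"
    using kl subgroup_nat_pow_closed[OF D] subgroup.m_closed[OF D] by blast
  finally show "a \<otimes> b \<in> tau G"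
    unfolding tau_iff_nat using kl by (intro conjI exI[of _ "k * l"]) auto
qed

lemma normal_tau: "tau G \<lhd> G"
  using subgroup_central_imp_normal[OF subgroup_tau tau_central] .

lemma tau_fg: obtains T where "finite T" "T \<subseteq> tau G" "generate G T = tau G"
  using polycyclic_subgroup_fg[OF polycyclic subgroup_tau subgroup.subset[OF subgroup_tau]] by blast

text \<open>Here [y,x]^r = [y^r,x] = [x^r,x] = 1, so x and y commute, and then the r-th power of x
  y^{-1} is trivial.\<close>

lemma root_unique:
  assumes "x \<in> carrier G" "y \<in> carrier G" "x [^] (r::nat) = y [^] r" "r > 0"
  shows "x = y"
proof -
  let ?z = "inv y \<otimes> x"
  have "comm G y x [^] r = comm G (x [^] r) x"
    using comm_pow_left[of y x r] assms by simp
  also have "\<dots> = \<one>"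
  proof -
    have "x [^] r \<otimes> x = x \<otimes> x [^] r" using assms(1) by (simp add: group_commutes_pow)
    then have "comm G (x [^] r) x = x \<otimes> x [^] r \<otimes> inv (x [^] r) \<otimes> inv x" by simp
    then show ?thesis using assms(1) by (simp add: m_assoc)
  qed
  finally have "comm G y x = \<one>"
    using tf assms unfolding torsion_free_def by blast
  then have xy: "y \<otimes> x = x \<otimes> y" using mult_eq_comm_mult[of y x] assms by simp
  then have "inv y \<otimes> (y \<otimes> x) \<otimes> inv y = inv y \<otimes> (x \<otimes> y) \<otimes> inv y" by simp
  then have "x \<otimes> inv y = inv y \<otimes> x" using assms by (simp add: m_assoc)
  then have "(x \<otimes> inv y) [^] r = x [^] r \<otimes> inv y [^] r"
    using assms by (intro pow_mult_distrib) auto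
  also have "\<dots> = \<one>" using assms by (simp add: nat_pow_inv)
  finally have "x \<otimes> inv y = \<one>" using tf assms unfolding torsion_free_def by auto
  then show ?thesis using assms by (metis inv_closed inv_equality inv_inv)
qed

end

lemma (in group) nilpotent_of_class_2_iff:
  "nilpotent_of_class G 2 \<longleftrightarrow> class_two_group G \<and> derived G (carrier G) \<noteq> {\<one>}"
proof -
  have D: "lower_central G 1 = derived G (carrier G)"
    unfolding derived_def by (auto simp: commutator_subgroup_def intro!: arg_cong[where f = "generate G"])
  have Dc: "derived G (carrier G) \<subseteq> carrier G" by (rule derived_in_carrier) simp
  have L2: "lower_central G 2 = generate G {comm G a b | a b. a \<in> derived G (carrier G) \<and> b \<in> carrier G}"
    using D by (simp add: numeral_2_eq_2 commutator_subgroup_def)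
  have "lower_central G 2 = {\<one>} \<longleftrightarrow> class_two_group G"
  proof
    assume 1: "lower_central G 2 = {\<one>}"
    show "class_two_group G"
    proof unfold_locales
      fix x y assume xy: "x \<in> carrier G" "y \<in> carrier G"
      define c where "c = comm G x y"
      have c: "c \<in> derived G (carrier G)" unfolding derived_def c_def using xy by (intro generate.incl) blast
      have cc: "c \<in> carrier G" using c Dc by blast
      have "c \<otimes> z = z \<otimes> c" if z: "z \<in> carrier G" for z
      proof -
        have "comm G c z \<in> lower_central G 2" unfolding L2 using c z by (intro generate.incl) blast
        then have "comm G c z = \<one>" using 1 by blast
        then have "comm G c z \<otimes> (z \<otimes> c) = z \<otimes> c" using z cc by simp
        then show ?thesis using z cc by (simp add: m_assoc)
      qed
      then show "comm G x y \<in> center G" using cc unfolding c_def center_def by blast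
    qed
  next
    assume "class_two_group G"
    then interpret class_two_group G .
    have "comm G a b = \<one>" if "a \<in> derived G (carrier G)" "b \<in> carrier G" for a b
    proof -
      have "a \<otimes> b = b \<otimes> a" "a \<in> carrier G" using derived_central that unfolding center_def by auto
      then show ?thesis using that by (simp add: m_assoc)
    qed
    then have "{comm G a b | a b. a \<in> derived G (carrier G) \<and> b \<in> carrier G} \<subseteq> {\<one>}" by blast
    then show "lower_central G 2 = {\<one>}"
      unfolding L2 using generate_subgroup_incl[OF _ triv_subgroup] generate.one by blast
  qed
  moreover have "derived G (carrier G) = {\<one>}" if "carrier G = {\<one>}"
    using Dc that subgroup.one_closed[OF derived_is_subgroup[OF subset_refl]] by blast
  moreover have "(\<forall>i<2. lower_central G i \<noteq> {\<one>}) \<longleftrightarrow> carrier G \<noteq> {\<one>} \<and> derived G (carrier G) \<noteq> {\<one>}"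
    using D by (auto simp: numeral_2_eq_2 less_Suc_eq)
  ultimately show ?thesis unfolding nilpotent_of_class_def by blast
qed

section \<open>Finitely generated torsion-free abelian groups\<close>

context comm_group
begin

definition lin :: "(nat \<Rightarrow> 'a) \<Rightarrow> nat set \<Rightarrow> (nat \<Rightarrow> int) \<Rightarrow> 'a" where
  "lin x I a = finprod G (\<lambda>i. x i [^] a i) I"

definition spans :: "(nat \<Rightarrow> 'a) \<Rightarrow> nat set \<Rightarrow> bool" where
  "spans x I \<longleftrightarrow> finite I \<and> x ` I \<subseteq> carrier G \<and> carrier G \<subseteq> range (lin x I)"

lemma lin_closed: "x ` I \<subseteq> carrier G \<Longrightarrow> lin x I a \<in> carrier G"
  unfolding lin_def by (intro finprod_closed) auto

lemma lin_add:
  assumes "x ` I \<subseteq> carrier G"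
  shows "lin x I (\<lambda>i. a i + b i) = lin x I a \<otimes> lin x I b"
proof -
  have "lin x I (\<lambda>i. a i + b i) = finprod G (\<lambda>i. x i [^] a i \<otimes> x i [^] b i) I"
    unfolding lin_def using assms by (intro finprod_cong') (auto simp: int_pow_mult)
  also have "\<dots> = lin x I a \<otimes> lin x I b"
    unfolding lin_def using assms by (intro finprod_multf) auto
  finally show ?thesis .
qed

lemma lin_zero: "lin x I (\<lambda>i. 0) = \<one>"
  unfolding lin_def by simp

lemma lin_cong:
  assumes "x ` I \<subseteq> carrier G" "\<And>i. i \<in> I \<Longrightarrow> a i = b i" "\<And>i. i \<in> I \<Longrightarrow> x i = y i"
  shows "lin x I a = lin y I b"
proof -
  have "y ` I \<subseteq> carrier G" using assms(1,3) by force
  then show ?thesis unfolding lin_def using assms by (intro finprod_cong') auto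
qed

lemma lin_remove:
  assumes "finite I" "x ` I \<subseteq> carrier G" "i \<in> I"
  shows "lin x I a = x i [^] a i \<otimes> lin x (I - {i}) a"
proof -
  have "I = insert i (I - {i})" using assms(3) by blast
  then have "lin x I a = lin x (insert i (I - {i})) a" by simp
  also have "\<dots> = x i [^] a i \<otimes> lin x (I - {i}) a"
    unfolding lin_def using assms by (intro finprod_insert) auto
  finally show ?thesis .
qed

text \<open>Replacing x_j by x_j x_i^e is undone by subtracting e b_j from the coefficient at i.
  Thus the span survives, and a relation changes in one coefficient only.\<close>

lemma lin_elementary:
  assumes I: "finite I" "x ` I \<subseteq> carrier G" and ij: "i \<in> I" "j \<in> I" "i \<noteq> j"
  shows "lin (x(j := x j \<otimes> x i [^] (e::int))) I (b(i := b i - e * b j)) = lin x I b"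
proof -
  let ?y = "x(j := x j \<otimes> x i [^] e)" and ?c = "b(i := b i - e * b j)"
  have xi: "x i \<in> carrier G" and xj: "x j \<in> carrier G" using I ij by auto
  have y: "?y ` I \<subseteq> carrier G" using I(2) xi xj by auto
  let ?K = "I - {i} - {j}"
  have K: "lin ?y ?K ?c = lin x ?K b" by (rule lin_cong) (use y in auto)
  have cl: "lin x ?K b \<in> carrier G" using I by (intro lin_closed) auto
  have split: "lin z I c = z i [^] c i \<otimes> (z j [^] c j \<otimes> lin z ?K c)" if "z ` I \<subseteq> carrier G" for z c
  proof -
    have "z ` (I - {i}) \<subseteq> carrier G" using that by blast
    then show ?thesis
      using lin_remove[OF I(1) that ij(1), of c] lin_remove[of "I - {i}" z j c] I ij by simp
  qed
  have "x i [^] (b i - e * b j) \<otimes> (x j \<otimes> x i [^] e) [^] b j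
    = x i [^] (b i - e * b j) \<otimes> (x i [^] (e * b j) \<otimes> x j [^] b j)"
    using xi xj by (simp add: int_pow_distrib int_pow_pow m_comm)
  also have "\<dots> = x i [^] b i \<otimes> x j [^] b j"
    using xi xj by (simp add: m_assoc[symmetric] int_pow_mult[symmetric])
  finally have "x i [^] (b i - e * b j) \<otimes> ((x j \<otimes> x i [^] e) [^] b j \<otimes> lin x ?K b)
    = x i [^] b i \<otimes> (x j [^] b j \<otimes> lin x ?K b)"
    using xi xj cl by (simp add: m_assoc[symmetric])
  then show ?thesis using split[OF y, of ?c] split[OF I(2), of b] ij(3) K by simp
qed

lemma generate_spans:
  assumes "finite S" "S \<subseteq> carrier G" "generate G S = carrier G"
  shows "\<exists>x I. spans x I"
proof -
  obtain ss where ss: "set ss = S" using assms(1) finite_list by blast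
  define x where "x i = ss ! i" for i
  define I where "I = {..<length ss}"
  have x: "x ` I \<subseteq> carrier G" using ss assms(2) unfolding x_def I_def by (auto simp: subset_iff)
  have gen: "\<exists>a. g = lin x I a" if "g \<in> generate G S" for g
    using that
  proof induction
    case one
    show ?case using lin_zero by metis
  next
    case (incl h)
    then obtain k where k: "k \<in> I" "h = x k" using ss unfolding x_def I_def by (auto simp: in_set_conv_nth)
    have "lin x I (\<lambda>i. if i = k then 1 else 0) = finprod G (\<lambda>i. if i = k then x i else \<one>) I"
      unfolding lin_def using x k by (intro finprod_cong') auto
    also have "\<dots> = h"
      using finprod_singleton_swap[OF k(1), of x] x k by (auto simp: I_def)
    finally show ?case by metis
  next
    case (inv h)
    then obtain k where k: "k \<in> I" "h = x k" using ss unfolding x_def I_def by (auto simp: in_set_conv_nth)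
    have "lin x I (\<lambda>i. if i = k then - 1 else 0) = finprod G (\<lambda>i. if i = k then inv (x i) else \<one>) I"
      unfolding lin_def using x k by (intro finprod_cong') (auto simp: int_pow_neg)
    also have "\<dots> = inv h"
      using finprod_singleton_swap[OF k(1), of "\<lambda>i. inv (x i)"] x k by (auto simp: I_def)
    finally show ?case by metis
  next
    case (eng g h)
    then show ?case using lin_add[OF x] by metis
  qed
  have "carrier G \<subseteq> range (lin x I)" using gen assms(3) by blast
  then have "spans x I" unfolding spans_def using x by (simp add: I_def)
  then show ?thesis by blast
qed

text \<open>Euclidean descent: a non-trivial relation can be shortened by a change of generators until it
  involves a single generator, which then is trivial and can be dropped.\<close>

lemma minimal_spans_independent:
  assumes tf: "torsion_free G"
    and min: "\<And>y J. spans y J \<Longrightarrow> card I \<le> card J"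
    and sp: "spans x I" and rel: "lin x I a = \<one>"
  shows "\<forall>i\<in>I. a i = 0"
  using sp rel
proof (induction "nat (\<Sum>i\<in>I. \<bar>a i\<bar>)" arbitrary: x a rule: less_induct)
  case less
  have fin: "finite I" and x: "x ` I \<subseteq> carrier G" and span: "carrier G \<subseteq> range (lin x I)"
    using less.prems unfolding spans_def by auto
  show ?case
  proof (rule ccontr)
    assume "\<not> ?thesis"
    then obtain k where k: "k \<in> I" "a k \<noteq> 0" by blast
    show False
    proof (cases "\<exists>l\<in>I. l \<noteq> k \<and> a l \<noteq> 0")
      case True
      then obtain l where "l \<in> I" "l \<noteq> k" "a l \<noteq> 0" by blast
      then obtain i j where ij: "i \<in> I" "j \<in> I" "i \<noteq> j" "a i \<noteq> 0" "a j \<noteq> 0" "\<bar>a j\<bar> \<le> \<bar>a i\<bar>"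
      proof (cases "\<bar>a l\<bar> \<le> \<bar>a k\<bar>")
        case True
        show ?thesis by (rule that[of k l]) (use True k \<open>l \<in> I\<close> \<open>l \<noteq> k\<close> \<open>a l \<noteq> 0\<close> in auto)
      next
        case False
        show ?thesis by (rule that[of l k]) (use False k \<open>l \<in> I\<close> \<open>l \<noteq> k\<close> \<open>a l \<noteq> 0\<close> in auto)
      qed
      \<comment> \<open>With this sign |a_i - e a_j| = |a_i| - |a_j|, so the sum of absolute values
        drops.\<close>
      define e where "e = sgn (a i) * sgn (a j)"
      define y where "y = x(j := x j \<otimes> x i [^] e)"
      define b where "b = a(i := a i - e * a j)"
      have b_less: "\<bar>b i\<bar> < \<bar>a i\<bar>"
        using ij(4-6) unfolding b_def e_def by (auto simp: sgn_if split: if_splits)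
      have "lin y I b = \<one>"
        using lin_elementary[OF fin x ij(1-3), of e a] less.prems unfolding y_def b_def by simp
      moreover have "spans y I"
        unfolding spans_def
      proof (intro conjI)
        show "y ` I \<subseteq> carrier G" using x ij(1,2) unfolding y_def by auto
        show "carrier G \<subseteq> range (lin y I)"
        proof
          fix g assume "g \<in> carrier G"
          then obtain c where "g = lin x I c" using span by blast
          then have "g = lin y I (c(i := c i - e * c j))"
            using lin_elementary[OF fin x ij(1-3), of e c] unfolding y_def by simp
          then show "g \<in> range (lin y I)" by blast
        qed
      qed (rule fin)
      moreover have "nat (\<Sum>i\<in>I. \<bar>b i\<bar>) < nat (\<Sum>i\<in>I. \<bar>a i\<bar>)"
      proof -
        have "(\<Sum>i\<in>I. \<bar>b i\<bar>) < (\<Sum>i\<in>I. \<bar>a i\<bar>)"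
        proof (rule sum_strict_mono_ex1[OF fin])
          show "\<forall>m\<in>I. \<bar>b m\<bar> \<le> \<bar>a m\<bar>" using b_less unfolding b_def by auto
          show "\<exists>m\<in>I. \<bar>b m\<bar> < \<bar>a m\<bar>" using b_less ij(1) by blast
        qed
        moreover have "0 \<le> (\<Sum>i\<in>I. \<bar>b i\<bar>)" by (rule sum_nonneg) simp
        ultimately show ?thesis by linarith
      qed
      ultimately have "\<forall>i\<in>I. b i = 0" using less.hyps by blast
      \<comment> \<open>The coefficient at j was not touched, so a_j would vanish.\<close>
      then have "b j = 0" using ij(2) by blast
      then show False using ij(3,5) unfolding b_def by simp
    next
      case False
      have one: "lin x (I - {k}) a = \<one>"
        using lin_cong[of x "I - {k}" a "\<lambda>i. 0" x] False x lin_zero by auto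
      then have "x k [^] a k = \<one>"
        using less.prems lin_remove[OF fin x k(1), of a] x k by auto
      then have xk: "x k = \<one>" using torsion_free_int_powD[OF tf] x k by blast
      have "spans x (I - {k})"
        unfolding spans_def
      proof (intro conjI)
        show "carrier G \<subseteq> range (lin x (I - {k}))"
        proof
          fix g assume "g \<in> carrier G"
          then obtain c where "g = lin x I c" using span by blast
          moreover have "lin x (I - {k}) c \<in> carrier G" using x by (intro lin_closed) auto
          ultimately have "g = lin x (I - {k}) c"
            using lin_remove[OF fin x k(1), of c] xk by simp
          then show "g \<in> range (lin x (I - {k}))" by blast
        qed
      qed (use fin x in auto)
      then have "card I \<le> card (I - {k})" by (rule min)
      then show False using k fin by (metis card_Diff1_less leD)
    qed
  qed
qed

text \<open>A spanning family with the fewest members is independent, hence a basis.\<close>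

lemma torsion_free_fg_iso_Z_power:
  assumes tf: "torsion_free G" and S: "finite S" "S \<subseteq> carrier G" "generate G S = carrier G"
  shows "\<exists>d. G \<cong> Z_power d"
proof -
  define P where "P d \<longleftrightarrow> (\<exists>x I. spans x I \<and> card I = d)" for d
  have "\<exists>d. P d" using generate_spans[OF S] unfolding P_def by blast
  then have "P (LEAST d. P d)" by (rule LeastI_ex)
  then obtain x I where xI: "spans x I" "card I = (LEAST d. P d)" unfolding P_def by blast
  have min: "card I \<le> card J" if "spans y J" for y J
    unfolding xI(2) by (rule Least_le) (use that in \<open>auto simp: P_def\<close>)
  have fin: "finite I" and x: "x ` I \<subseteq> carrier G" and span: "carrier G \<subseteq> range (lin x I)"
    using xI unfolding spans_def by auto
  define d where "d = card I"
  obtain h where h: "bij_betw h {..<d} I"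
    using ex_bij_betw_nat_finite[OF fin] unfolding d_def lessThan_atLeast0 by blast
  have inj: "inj_on h {..<d}" and img: "h ` {..<d} = I" using h by (auto simp: bij_betw_def)
  define \<Phi> where "\<Phi> a = lin (x \<circ> h) {..<d} a" for a
  have reindex: "lin x I a = \<Phi> (a \<circ> h)" for a
    unfolding \<Phi>_def lin_def img[symmetric]
    using x by (subst finprod_reindex[OF _ inj]) (auto simp: img)
  have xh: "(x \<circ> h) ` {..<d} \<subseteq> carrier G" using x img by (auto simp: image_comp[symmetric])
  have Z: "group (Z_power d)" unfolding Z_power_def by simp
  have "\<Phi> \<in> hom (Z_power d) G"
  proof (rule homI)
    show "\<Phi> a \<in> carrier G" for a unfolding \<Phi>_def by (rule lin_closed[OF xh])
    show "\<Phi> (a \<otimes>\<^bsub>Z_power d\<^esub> b) = \<Phi> a \<otimes> \<Phi> b" for a b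
      unfolding \<Phi>_def lin_add[OF xh, symmetric]
      by (rule lin_cong[OF xh]) (auto simp: Z_power_def)
  qed
  moreover have "bij_betw \<Phi> (carrier (Z_power d)) (carrier G)"
    unfolding bij_betw_def
  proof (intro conjI inj_onI equalityI subsetI)
    fix a b assume ab: "a \<in> carrier (Z_power d)" "b \<in> carrier (Z_power d)" "\<Phi> a = \<Phi> b"
    \<comment> \<open>The difference of the two coordinate vectors, moved to the index set
      \<open>I\<close> along \<open>h\<close>; equality of the two values of \<Phi> makes it a
      relation.\<close>
    define c where "c i = a (the_inv_into {..<d} h i) - b (the_inv_into {..<d} h i)" for i
    have c: "c (h i) = a i - b i" if "i < d" for i
      using the_inv_into_f_f[OF inj, of i] that by (simp add: c_def)
    have "\<Phi> b \<otimes> lin x I c = \<Phi> a"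
      unfolding reindex unfolding \<Phi>_def lin_add[OF xh, symmetric]
      by (rule lin_cong[OF xh]) (auto simp: c)
    moreover have "\<Phi> b \<in> carrier G" "lin x I c \<in> carrier G"
      unfolding \<Phi>_def using lin_closed[OF xh] lin_closed[OF x] by auto
    ultimately have "lin x I c = \<one>" using ab(3) by simp
    then have "\<forall>i\<in>I. c i = 0"
      by (intro minimal_spans_independent[OF tf _ xI(1)] min)
    then have "\<forall>i<d. c (h i) = 0" using img by blast
    then have "\<forall>i<d. a i = b i" using c by simp
    then show "a = b" using ab(1,2) unfolding Z_power_def
      by (auto simp: PiE_iff intro: extensionalityI)
  next
    fix g assume "g \<in> \<Phi> ` carrier (Z_power d)"
    then show "g \<in> carrier G" unfolding \<Phi>_def using lin_closed[OF xh] by blast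
  next
    fix g assume "g \<in> carrier G"
    then obtain a where "g = \<Phi> (a \<circ> h)" using span reindex by blast
    also have "\<dots> = \<Phi> (restrict (a \<circ> h) {..<d})"
      unfolding \<Phi>_def by (rule lin_cong[OF xh]) auto
    finally show "g \<in> \<Phi> ` carrier (Z_power d)" unfolding Z_power_def by auto
  qed
  ultimately have "Z_power d \<cong> G" unfolding is_iso_def iso_def by blast
  then show ?thesis using group.iso_sym[OF Z] by blast
qed

end

section \<open>Coordinates and counting\<close>

text \<open>The first two claims hold because g factors through f by the map \<open>h\<close>; if
  the image of g is not smaller, \<open>h\<close> is injective, which is the third.\<close>

lemma card_image_factor:
  assumes fin: "finite (f ` S)" and fac: "\<And>x y. \<lbrakk>x \<in> S; y \<in> S; f x = f y\<rbrakk> \<Longrightarrow> g x = g y"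
  shows "finite (g ` S)" "card (g ` S) \<le> card (f ` S)"
    and "\<lbrakk>card (f ` S) \<le> card (g ` S); x \<in> S; y \<in> S; g x = g y\<rbrakk> \<Longrightarrow> f x = f y"
proof -
  define h where "h v = g (inv_into S f v)" for v
  have h: "h (f x) = g x" if "x \<in> S" for x
    unfolding h_def by (rule fac) (use that in \<open>auto intro: inv_into_into f_inv_into_f\<close>)
  have img: "h ` f ` S = g ` S" using h by (force simp: image_image)
  show "finite (g ` S)" unfolding img[symmetric] using fin by simp
  show le: "card (g ` S) \<le> card (f ` S)" unfolding img[symmetric] using fin by (rule card_image_le)
  assume "card (f ` S) \<le> card (g ` S)" and xy: "x \<in> S" "y \<in> S" "g x = g y"
  then have "card (h ` f ` S) = card (f ` S)" using le img by simp
  then have "inj_on h (f ` S)" using fin by (rule eq_card_imp_inj_on[rotated])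
  moreover have "h (f x) = h (f y)" using h[OF xy(1)] h[OF xy(2)] xy(3) by simp
  ultimately show "f x = f y" using xy(1,2) by (blast dest: inj_onD)
qed

text \<open>An isomorphism of \<open>S\<close> modulo \<open>T\<close> with Z^n without a quotient
  group: the entries of \<alpha> below n give a homomorphism of \<open>S\<close> onto Z^n whose
  kernel consists of the elements of \<open>S\<close> lying in \<open>T\<close>. Entries from n on
  are arbitrary.\<close>

definition coords :: "('a, 'b) monoid_scheme \<Rightarrow> 'a set \<Rightarrow> 'a set \<Rightarrow> nat \<Rightarrow> ('a \<Rightarrow> nat \<Rightarrow> int) \<Rightarrow> bool" where
  "coords G S T n \<alpha> \<longleftrightarrow>
     (\<forall>x\<in>S. \<forall>y\<in>S. \<forall>i<n. \<alpha> (x \<otimes>\<^bsub>G\<^esub> y) i = \<alpha> x i + \<alpha> y i) \<and>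
     (\<forall>a. \<exists>x\<in>S. \<forall>i<n. \<alpha> x i = a i) \<and>
     (\<forall>x\<in>S. (\<forall>i<n. \<alpha> x i = 0) \<longleftrightarrow> x \<in> T)"

lemma Z_power_mult: "i < n \<Longrightarrow> (a \<otimes>\<^bsub>Z_power n\<^esub> b) i = a i + b i"
  unfolding Z_power_def by simp

lemma Z_power_eq_one_iff: "a \<in> carrier (Z_power n) \<Longrightarrow> a = \<one>\<^bsub>Z_power n\<^esub> \<longleftrightarrow> (\<forall>i<n. a i = 0)"
  unfolding Z_power_def by (auto simp: PiE_iff intro!: extensionalityI[of _ "{..<n}"])

lemma iso_Z_power_coords:
  assumes "group K" "f \<in> iso K (Z_power n)"
  shows "\<forall>x\<in>carrier K. \<forall>y\<in>carrier K. \<forall>i<n. f (x \<otimes>\<^bsub>K\<^esub> y) i = f x i + f y i"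
    and "\<exists>x\<in>carrier K. \<forall>i<n. f x i = a i"
    and "x \<in> carrier K \<Longrightarrow> (\<forall>i<n. f x i = 0) \<longleftrightarrow> x = \<one>\<^bsub>K\<^esub>"
proof -
  have Z: "group (Z_power n)" unfolding Z_power_def by simp
  have hom: "f \<in> hom K (Z_power n)" and bij: "bij_betw f (carrier K) (carrier (Z_power n))"
    using assms(2) unfolding iso_def by auto
  show "\<forall>x\<in>carrier K. \<forall>y\<in>carrier K. \<forall>i<n. f (x \<otimes>\<^bsub>K\<^esub> y) i = f x i + f y i"
    using hom_mult[OF hom] Z_power_mult by metis
  have "restrict a {..<n} \<in> carrier (Z_power n)" unfolding Z_power_def by auto
  then obtain y where "y \<in> carrier K" "f y = restrict a {..<n}"
    using bij unfolding bij_betw_def by (metis imageE)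
  then show "\<exists>x\<in>carrier K. \<forall>i<n. f x i = a i" by (intro bexI[of _ y]) auto
  assume x: "x \<in> carrier K"
  have f1: "f \<one>\<^bsub>K\<^esub> = \<one>\<^bsub>Z_power n\<^esub>" using hom_one[OF hom assms(1) Z] .
  have fx: "f x \<in> carrier (Z_power n)" using hom x by (rule hom_in_carrier)
  have "f x = \<one>\<^bsub>Z_power n\<^esub> \<longleftrightarrow> x = \<one>\<^bsub>K\<^esub>"
    using bij x f1 group.is_monoid[OF assms(1)] unfolding bij_betw_def inj_on_def
    by (metis monoid.one_closed)
  then show "(\<forall>i<n. f x i = 0) \<longleftrightarrow> x = \<one>\<^bsub>K\<^esub>" using Z_power_eq_one_iff[OF fx] by simp
qed

context group
begin

lemma r_coset_eq_iff:
  assumes "subgroup N G" "x \<in> carrier G" "y \<in> carrier G"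
  shows "N #> x = N #> y \<longleftrightarrow> x \<otimes> inv y \<in> N"
proof -
  interpret N: subgroup N G by fact
  have "x \<otimes> inv y \<in> N \<longleftrightarrow> x \<in> N #> y" using N.rcos_module[OF is_group assms(3,2)] by simp
  also have "\<dots> \<longleftrightarrow> N #> x = N #> y"
    using repr_independence[of x N y] rcos_self[OF assms(2,1)] assms by auto
  finally show ?thesis by simp
qed

section \<open>Coordinates and their residues modulo q\<close>

lemma coords_one:
  assumes "subgroup S G" "coords G S T n \<alpha>" "i < n"
  shows "\<alpha> \<one> i = 0"
proof -
  have "\<alpha> (\<one> \<otimes> \<one>) i = \<alpha> \<one> i + \<alpha> \<one> i"
    using assms subgroup.one_closed[OF assms(1)] unfolding coords_def by blast
  then show ?thesis by simp
qed

lemma coords_mult: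
  assumes "coords G S T n \<alpha>" "x \<in> S" "y \<in> S" "i < n"
  shows "\<alpha> (x \<otimes> y) i = \<alpha> x i + \<alpha> y i"
  using assms unfolding coords_def by blast

lemma coords_inv:
  assumes "subgroup S G" "coords G S T n \<alpha>" "x \<in> S" "i < n"
  shows "\<alpha> (inv x) i = - \<alpha> x i"
proof -
  have "\<alpha> (inv x \<otimes> x) i = \<alpha> (inv x) i + \<alpha> x i"
    using assms subgroup.m_inv_closed[OF assms(1)] by (intro coords_mult) auto
  then show ?thesis using assms subgroup.mem_carrier[OF assms(1)] coords_one[OF assms(1,2,4)] by simp
qed

lemma coords_pow:
  assumes "subgroup S G" "coords G S T n \<alpha>" "x \<in> S" "i < n"
  shows "\<alpha> (x [^] (k::nat)) i = int k * \<alpha> x i"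
proof (induction k)
  case 0
  then show ?case using coords_one[OF assms(1,2,4)] by simp
next
  case (Suc k)
  then show ?case
    using coords_mult[OF assms(2) subgroup_nat_pow_closed[OF assms(1,3)] assms(3,4), of k]
    by (simp add: algebra_simps)
qed

text \<open>Surjectivity gives u whose coordinates are the differences divided by q; what remains
  after removing u^q has zero coordinates, hence lies in \<open>T\<close>.\<close>

lemma coords_cong_mod:
  assumes S: "subgroup S G" and co: "coords G S T n \<alpha>" and xy: "x \<in> S" "y \<in> S"
    and cong: "\<forall>i<n. \<alpha> x i mod int q = \<alpha> y i mod int q"
  obtains u z where "u \<in> S" "z \<in> T" "z \<in> S" "x = y \<otimes> u [^] q \<otimes> z"
proof -
  interpret S: subgroup S G by fact
  have "\<forall>i<n. \<exists>c. \<alpha> x i - \<alpha> y i = int q * c"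
    using cong by (metis dvd_def mod_eq_dvd_iff)
  then obtain c where c: "\<And>i. i < n \<Longrightarrow> \<alpha> x i - \<alpha> y i = int q * c i" by metis
  obtain u where u: "u \<in> S" "\<forall>i<n. \<alpha> u i = c i" using co unfolding coords_def by blast
  define z where "z = inv (y \<otimes> u [^] q) \<otimes> x"
  have uq: "u [^] q \<in> S" using subgroup_nat_pow_closed[OF S u(1)] .
  have yu: "y \<otimes> u [^] q \<in> S" using xy uq by blast
  have z: "z \<in> S" unfolding z_def using xy yu by blast
  have "\<alpha> z i = 0" if i: "i < n" for i
    unfolding z_def
    using coords_mult[OF co _ _ i] coords_inv[OF S co _ i] coords_pow[OF S co u(1) i, of q] c[OF i] u(2) i xy yu uq
    by simp
  then have "z \<in> T" using co z unfolding coords_def by blast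
  moreover have "x = y \<otimes> u [^] q \<otimes> z"
    unfolding z_def using S.mem_carrier xy uq by (simp add: m_assoc)
  ultimately show thesis using that u z by blast
qed

lemma card_residues:
  assumes co: "coords G S T n \<alpha>" and q: "q > 0"
  shows "finite ((\<lambda>x. \<lambda>i\<in>{..<n}. \<alpha> x i mod int q) ` S)"
    and "card ((\<lambda>x. \<lambda>i\<in>{..<n}. \<alpha> x i mod int q) ` S) = q ^ n"
proof -
  have "(\<lambda>x. \<lambda>i\<in>{..<n}. \<alpha> x i mod int q) ` S = (\<Pi>\<^sub>E i\<in>{..<n}. {0..<int q})" (is "?f ` S = ?P")
  proof (intro equalityI subsetI)
    fix a assume a: "a \<in> ?P"
    obtain x where x: "x \<in> S" "\<forall>i<n. \<alpha> x i = a i" using co unfolding coords_def by blast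
    have "?f x = a"
      using a x by (intro extensionalityI[of _ "{..<n}"]) (auto simp: PiE_iff)
    then show "a \<in> ?f ` S" using x(1) by blast
  qed (use q in auto)
  then show "finite (?f ` S)" "card (?f ` S) = q ^ n"
    by (simp_all add: finite_PiE card_PiE)
qed

text \<open>By \<open>coords_cong_mod\<close> such a \<phi> depends only on the residues of the
  coordinates modulo q.\<close>

lemma coords_card_upper:
  assumes S: "subgroup S G" and co: "coords G S T n \<alpha>" and q: "q > 0"
    and \<phi>: "\<And>y u z. \<lbrakk>y \<in> S; u \<in> S; z \<in> T; z \<in> S\<rbrakk> \<Longrightarrow> \<phi> (y \<otimes> u [^] q \<otimes> z) = \<phi> y"
  shows "finite (\<phi> ` S)" "card (\<phi> ` S) \<le> q ^ n"
proof -
  have fac: "\<phi> x = \<phi> y"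
    if xy: "x \<in> S" "y \<in> S" "(\<lambda>i\<in>{..<n}. \<alpha> x i mod int q) = (\<lambda>i\<in>{..<n}. \<alpha> y i mod int q)" for x y
  proof -
    have "\<forall>i<n. \<alpha> x i mod int q = \<alpha> y i mod int q"
      using xy(3) by (metis lessThan_iff restrict_apply')
    then obtain u z where "u \<in> S" "z \<in> T" "z \<in> S" "x = y \<otimes> u [^] q \<otimes> z"
      by (rule coords_cong_mod[OF S co xy(1,2)])
    then show ?thesis using \<phi> xy by simp
  qed
  show "finite (\<phi> ` S)" by (rule card_image_factor(1)[OF card_residues(1)[OF co q]]) (rule fac)
  have "card (\<phi> ` S) \<le> card ((\<lambda>x. \<lambda>i\<in>{..<n}. \<alpha> x i mod int q) ` S)"
    by (rule card_image_factor(2)[OF card_residues(1)[OF co q]]) (rule fac)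
  then show "card (\<phi> ` S) \<le> q ^ n" unfolding card_residues(2)[OF co q] .
qed

text \<open>The reverse situation: the residue vector factors through \<phi>.\<close>

lemma coords_card_lower:
  assumes co: "coords G S T n \<alpha>" and q: "q > 0" and fin: "finite (\<phi> ` S)"
    and \<phi>: "\<And>x y i. \<lbrakk>x \<in> S; y \<in> S; \<phi> x = \<phi> y; i < n\<rbrakk> \<Longrightarrow> int q dvd \<alpha> x i - \<alpha> y i"
  shows "q ^ n \<le> card (\<phi> ` S)"
proof -
  have "card ((\<lambda>x. \<lambda>i\<in>{..<n}. \<alpha> x i mod int q) ` S) \<le> card (\<phi> ` S)"
    by (rule card_image_factor(2)[OF fin]) (auto simp: mod_eq_dvd_iff \<phi> intro!: restrict_ext)
  then show ?thesis unfolding card_residues(2)[OF co q] .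
qed

end

text \<open>Both sides are the derived subgroup of \<open>G Mod N\<close>, as images under
  surjective homomorphisms.\<close>

lemma quotient_derived_image:
  assumes "group G" "group H" "N \<lhd> G" "\<phi> \<in> hom H (G Mod N)" "\<phi> ` carrier H = carrier (G Mod N)"
  shows "\<phi> ` derived H (carrier H) = (\<lambda>x. N #>\<^bsub>G\<^esub> x) ` derived G (carrier G)"
proof -
  interpret G: group G by fact
  interpret N: normal N G by fact
  interpret \<phi>: group_hom H "G Mod N" \<phi>
    using assms N.factorgroup_is_group by (simp add: group_hom_def group_hom_axioms_def)
  interpret \<pi>: group_hom G "G Mod N" "\<lambda>x. N #>\<^bsub>G\<^esub> x"
    using assms N.factorgroup_is_group N.r_coset_hom_Mod by (simp add: group_hom_def group_hom_axioms_def)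
  have "\<phi> ` derived H (carrier H) = derived (G Mod N) (\<phi> ` carrier H)"
    by (rule \<phi>.derived_img[symmetric]) simp
  also have "\<dots> = derived (G Mod N) ((\<lambda>x. N #>\<^bsub>G\<^esub> x) ` carrier G)"
    using assms(5) by (simp add: carrier_FactGroup)
  also have "\<dots> = (\<lambda>x. N #>\<^bsub>G\<^esub> x) ` derived G (carrier G)"
    by (rule \<pi>.derived_img) simp
  finally show ?thesis .
qed

context tf_class_two_group
begin

lemma iso_coords:
  assumes "G Mod tau G \<cong> Z_power n" "G\<lparr>carrier := tau G\<rparr> \<cong> Z_power m"
  obtains \<alpha> \<beta> where "coords G (carrier G) (tau G) n \<alpha>" "coords G (tau G) {\<one>} m \<beta>"
proof -
  interpret T: normal "tau G" G by (rule normal_tau)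
  obtain f where f: "f \<in> iso (G Mod tau G) (Z_power n)" using assms(1) unfolding is_iso_def by blast
  obtain \<beta> where \<beta>: "\<beta> \<in> iso (G\<lparr>carrier := tau G\<rparr>) (Z_power m)" using assms(2) unfolding is_iso_def by blast
  note f' = iso_Z_power_coords[OF T.factorgroup_is_group f]
  note \<beta>' = iso_Z_power_coords[OF subgroup_imp_group[OF subgroup_tau] \<beta>]
  define \<alpha> where "\<alpha> x = f (tau G #> x)" for x
  have cl: "tau G #> x \<in> carrier (G Mod tau G)" if "x \<in> carrier G" for x
    using that by (simp add: carrier_FactGroup)
  have "coords G (carrier G) (tau G) n \<alpha>"
    unfolding coords_def \<alpha>_def
  proof (intro conjI ballI allI impI)
    fix x y i assume "x \<in> carrier G" "y \<in> carrier G" "i < n"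
    then show "f (tau G #> (x \<otimes> y)) i = f (tau G #> x) i + f (tau G #> y) i"
      using f'(1) cl T.rcos_sum by (metis mult_FactGroup)
  next
    fix a :: "nat \<Rightarrow> int"
    show "\<exists>x\<in>carrier G. \<forall>i<n. f (tau G #> x) i = a i"
      using f'(2)[of a] by (simp add: carrier_FactGroup)
  next
    fix x assume x: "x \<in> carrier G"
    have "tau G #> x = tau G \<longleftrightarrow> x \<in> tau G"
      using r_coset_eq_iff[OF subgroup_tau x one_closed] x T.subset by simp
    then show "(\<forall>i<n. f (tau G #> x) i = 0) \<longleftrightarrow> x \<in> tau G" using f'(3)[OF cl[OF x]] by simp
  qed
  moreover have "coords G (tau G) {\<one>} m \<beta>"
    using \<beta>' unfolding coords_def by simp
  ultimately show thesis using that by blast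
qed

text \<open>Serves for the group whose ranks are still unknown. The quotient by \<open>tau G\<close>
  has no torsion because roots of elements of \<open>tau G\<close> stay in it, and
  \<open>tau G\<close> is finitely generated as a subgroup of a polycyclic group.\<close>

lemma exists_class_I:
  assumes "derived G (carrier G) \<noteq> {\<one>}"
  obtains n m where "class_I n m G"
proof -
  interpret T: normal "tau G" G by (rule normal_tau)
  note T_grp = T.factorgroup_is_group
  interpret Q: comm_group "G Mod tau G"
  proof (rule group.group_comm_groupI[OF T_grp])
    fix u v assume "u \<in> carrier (G Mod tau G)" "v \<in> carrier (G Mod tau G)"
    then obtain x y where *: "x \<in> carrier G" "y \<in> carrier G" "u = tau G #> x" "v = tau G #> y"
      by (auto simp: carrier_FactGroup)
    have "comm G x y \<in> derived G (carrier G)" unfolding derived_def using * by (intro generate.incl) blast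
    then have "x \<otimes> y \<otimes> inv (y \<otimes> x) \<in> tau G"
      using derived_subset_tau * by (auto simp: inv_mult_group m_assoc)
    then have "tau G #> (x \<otimes> y) = tau G #> (y \<otimes> x)"
      using r_coset_eq_iff[OF subgroup_tau] * by simp
    then show "u \<otimes>\<^bsub>G Mod tau G\<^esub> v = v \<otimes>\<^bsub>G Mod tau G\<^esub> u" using * by (simp add: T.rcos_sum)
  qed
  interpret \<pi>: group_hom G "G Mod tau G" "\<lambda>x. tau G #> x"
    using T_grp T.r_coset_hom_Mod by (simp add: group_hom_def group_hom_axioms_def is_group)
  obtain S where S: "finite S" "S \<subseteq> carrier G" "generate G S = carrier G"
    using fg unfolding finitely_generated_def by blast
  have "torsion_free (G Mod tau G)"
    unfolding torsion_free_def
  proof (intro ballI allI impI, elim conjE)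
    fix u and k :: nat
    assume u: "u \<in> carrier (G Mod tau G)" and k: "0 < k" "u [^]\<^bsub>G Mod tau G\<^esub> k = \<one>\<^bsub>G Mod tau G\<^esub>"
    obtain x where x: "x \<in> carrier G" "u = tau G #> x" using u by (auto simp: carrier_FactGroup)
    then have "tau G #> (x [^] k) = tau G" using k(2) \<pi>.hom_nat_pow[OF x(1), of k] by simp
    then have "x [^] k \<in> tau G"
      using r_coset_eq_iff[OF subgroup_tau _ one_closed, of "x [^] k"] x(1) T.subset by simp
    then have "x \<in> tau G" using pow_tau_imp_tau x(1) k(1) by blast
    then show "u = \<one>\<^bsub>G Mod tau G\<^esub>" using x(2) by (simp add: T.rcos_const[OF is_group])
  qed
  moreover have "generate (G Mod tau G) ((\<lambda>x. tau G #> x) ` S) = carrier (G Mod tau G)"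
    using \<pi>.generate_img[OF S(2)] S(3) by (simp add: carrier_FactGroup)
  moreover have "(\<lambda>x. tau G #> x) ` S \<subseteq> carrier (G Mod tau G)" using S(2) by (auto simp: carrier_FactGroup)
  ultimately have "\<exists>n. G Mod tau G \<cong> Z_power n"
    by (intro Q.torsion_free_fg_iso_Z_power[OF _ finite_imageI[OF S(1)]])
  then obtain n where n: "G Mod tau G \<cong> Z_power n" by blast
  interpret C: comm_group "G\<lparr>carrier := tau G\<rparr>"
  proof (rule group.group_comm_groupI[OF subgroup_imp_group[OF subgroup_tau]])
    fix x y assume "x \<in> carrier (G\<lparr>carrier := tau G\<rparr>)" "y \<in> carrier (G\<lparr>carrier := tau G\<rparr>)"
    then show "x \<otimes>\<^bsub>G\<lparr>carrier := tau G\<rparr>\<^esub> y = y \<otimes>\<^bsub>G\<lparr>carrier := tau G\<rparr>\<^esub> x"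
      using tau_central T.subset unfolding center_def by auto
  qed
  obtain U where U: "finite U" "U \<subseteq> tau G" "generate G U = tau G" using tau_fg by blast
  have "torsion_free (G\<lparr>carrier := tau G\<rparr>)"
    using tf T.subset unfolding torsion_free_def by (auto simp: nat_pow_consistent[symmetric])
  moreover have "generate (G\<lparr>carrier := tau G\<rparr>) U = carrier (G\<lparr>carrier := tau G\<rparr>)"
    using generate_consistent[OF U(2) subgroup_tau] U(3) by simp
  moreover have "U \<subseteq> carrier (G\<lparr>carrier := tau G\<rparr>)" using U(2) by simp
  ultimately have "\<exists>m. G\<lparr>carrier := tau G\<rparr> \<cong> Z_power m"
    by (intro C.torsion_free_fg_iso_Z_power[OF _ U(1)])
  then obtain m where m: "G\<lparr>carrier := tau G\<rparr> \<cong> Z_power m" by blast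
  have "nilpotent_of_class G 2"
    using nilpotent_of_class_2_iff assms class_two_group_axioms by blast
  then have "class_I n m G" using n m fg tf unfolding class_I_def by blast
  then show thesis using that by blast
qed

end

section \<open>Transfer of torsion-freeness and ranks\<close>

lemma (in normal) quotient_exponent:
  assumes "\<And>x. x \<in> carrier G \<Longrightarrow> x [^] (q::nat) \<in> H" "v \<in> carrier (G Mod H)"
  shows "v [^]\<^bsub>G Mod H\<^esub> q = \<one>\<^bsub>G Mod H\<^esub>"
proof -
  interpret \<pi>: group_hom G "G Mod H" "\<lambda>x. H #> x"
    using factorgroup_is_group r_coset_hom_Mod by (simp add: group_hom_def group_hom_axioms_def is_group)
  obtain x where x: "x \<in> carrier G" "v = H #> x" using assms(2) by (auto simp: carrier_FactGroup)
  have "v [^]\<^bsub>G Mod H\<^esub> q = H #> (x [^] q)" using \<pi>.hom_nat_pow[OF x(1), of q] x(2) by simp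
  also have "\<dots> = H" using assms(1)[OF x(1)] by (rule rcos_const[OF is_group])
  finally show ?thesis by simp
qed

text \<open>The target has exponent q, so the homomorphism kills \<open>power_subgroup L q\<close>.
  Applied in both directions, this lets the two quotients be compared by counting.\<close>

lemma power_quotient_factor:
  assumes K: "group K" and L: "group L"
    and \<phi>: "\<phi> \<in> hom L (K Mod power_subgroup K q)"
    and x: "x \<in> carrier L" and y: "y \<in> carrier L"
    and xy: "power_subgroup L q #>\<^bsub>L\<^esub> x = power_subgroup L q #>\<^bsub>L\<^esub> y"
  shows "\<phi> x = \<phi> y"
proof -
  interpret K: group K by fact
  interpret L: group L by fact
  interpret N: normal "power_subgroup K q" K by (rule K.power_subgroup_normal)
  interpret \<phi>: group_hom L "K Mod power_subgroup K q" \<phi>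
    using \<phi> L N.factorgroup_is_group by (simp add: group_hom_def group_hom_axioms_def)
  note [simp del] = one_FactGroup mult_FactGroup
  have "power_subgroup L q \<subseteq> kernel L (K Mod power_subgroup K q) \<phi>"
    unfolding power_subgroup_def[of L]
  proof (rule L.generate_subgroup_incl[OF _ \<phi>.subgroup_kernel], rule image_subsetI)
    fix z assume z: "z \<in> carrier L"
    have "\<phi> (z [^]\<^bsub>L\<^esub> q) = \<one>\<^bsub>K Mod power_subgroup K q\<^esub>"
      using \<phi>.hom_nat_pow[OF z, of q] N.quotient_exponent[OF K.power_in_power_subgroup \<phi>.hom_closed[OF z]]
      by simp
    then show "z [^]\<^bsub>L\<^esub> q \<in> kernel L (K Mod power_subgroup K q) \<phi>"
      using z unfolding kernel_def by simp
  qed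
  moreover have "x \<otimes>\<^bsub>L\<^esub> inv\<^bsub>L\<^esub> y \<in> power_subgroup L q"
    using L.r_coset_eq_iff[OF normal_imp_subgroup[OF L.power_subgroup_normal] x y] xy by simp
  ultimately have "\<phi> (x \<otimes>\<^bsub>L\<^esub> inv\<^bsub>L\<^esub> y) = \<one>\<^bsub>K Mod power_subgroup K q\<^esub>"
    unfolding kernel_def by blast
  moreover have "\<phi> x = \<phi> (x \<otimes>\<^bsub>L\<^esub> inv\<^bsub>L\<^esub> y) \<otimes>\<^bsub>K Mod power_subgroup K q\<^esub> \<phi> y"
    using x y \<phi>.hom_mult[of "x \<otimes>\<^bsub>L\<^esub> inv\<^bsub>L\<^esub> y" y] by (simp add: L.m_assoc)
  ultimately show ?thesis using y by simp
qed

lemma torsion_free_transfer: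
  assumes G: "tf_class_two_group G" and H: "fg_class_two_group H" and eq: "Con G = Con H"
  shows "torsion_free H"
proof (rule ccontr)
  interpret G: tf_class_two_group G by fact
  interpret H: fg_class_two_group H by fact
  assume "\<not> torsion_free H"
  then obtain t and r :: nat where t: "t \<in> carrier H" "t \<noteq> \<one>\<^bsub>H\<^esub>" "t [^]\<^bsub>H\<^esub> r = \<one>\<^bsub>H\<^esub>" "r > 0"
    unfolding torsion_free_def by blast
  obtain s :: nat where s: "s > 0" "t \<notin> power_subgroup H s"
    by (rule H.exists_power_subgroup_avoiding_torsion[OF t])
  \<comment> \<open>The factor 2 pays for \<open>power_subgroup_even\<close>; the remaining r s
    makes any g with g^r in \<open>?N\<close> an s-th power.\<close>
  define q where "q = 2 * (r * s)"
  have q: "q > 0" using t s unfolding q_def by simp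
  let ?N = "power_subgroup G q" and ?M = "power_subgroup H q"
  interpret N: normal ?N G by (rule G.power_subgroup_normal)
  interpret M: normal ?M H by (rule H.power_subgroup_normal)
  have finN: "finite (rcosets\<^bsub>G\<^esub> ?N)"
    by (rule G.finite_rcosets_exponent[OF G.power_subgroup_normal q G.power_in_power_subgroup])
  have finM: "finite (rcosets\<^bsub>H\<^esub> ?M)"
    by (rule H.finite_rcosets_exponent[OF H.power_subgroup_normal q H.power_in_power_subgroup])
  have imgN: "rcosets\<^bsub>G\<^esub> ?N = (\<lambda>x. ?N #>\<^bsub>G\<^esub> x) ` carrier G"
    and imgM: "rcosets\<^bsub>H\<^esub> ?M = (\<lambda>x. ?M #>\<^bsub>H\<^esub> x) ` carrier H"
    unfolding RCOSETS_def by auto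
  obtain \<phi> where \<phi>: "\<phi> \<in> hom H (G Mod ?N)" "\<phi> ` carrier H = carrier (G Mod ?N)"
    using finite_quotient_transfer[OF G.fg H.is_group eq N.normal_axioms finN] .
  obtain \<psi> where \<psi>: "\<psi> \<in> hom G (H Mod ?M)" "\<psi> ` carrier G = carrier (H Mod ?M)"
    using finite_quotient_transfer[OF H.fg G.is_group eq[symmetric] M.normal_axioms finM] .
  \<comment> \<open>Through \<psi> the quotient of \<open>H\<close> has no more elements than that
    of \<open>G\<close>; as \<phi> induces a map of the former onto the latter, that map is
    injective.\<close>
  have "card (\<psi> ` carrier G) \<le> card ((\<lambda>x. ?N #>\<^bsub>G\<^esub> x) ` carrier G)"
    by (rule card_image_factor(2)[OF finN[unfolded imgN]])
      (rule power_quotient_factor[OF H.is_group G.is_group \<psi>(1)])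
  then have le: "card ((\<lambda>x. ?M #>\<^bsub>H\<^esub> x) ` carrier H) \<le> card (\<phi> ` carrier H)"
    using \<phi>(2) \<psi>(2) by (simp add: carrier_FactGroup)
  have inj: "?M #>\<^bsub>H\<^esub> x = ?M #>\<^bsub>H\<^esub> y" if "x \<in> carrier H" "y \<in> carrier H" "\<phi> x = \<phi> y" for x y
    by (rule card_image_factor(3)[OF finM[unfolded imgM] _ le that])
      (rule power_quotient_factor[OF G.is_group H.is_group \<phi>(1)])
  interpret \<phi>: group_hom H "G Mod ?N" \<phi>
    using \<phi> N.factorgroup_is_group by (simp add: group_hom_def group_hom_axioms_def H.is_group)
  interpret \<pi>: group_hom G "G Mod ?N" "\<lambda>x. ?N #>\<^bsub>G\<^esub> x"
    using N.factorgroup_is_group N.r_coset_hom_Mod by (simp add: group_hom_def group_hom_axioms_def G.is_group)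
  obtain g where g: "g \<in> carrier G" "\<phi> t = ?N #>\<^bsub>G\<^esub> g"
    using \<phi>.hom_closed[OF t(1)] by (auto simp: carrier_FactGroup)
  have "?N #>\<^bsub>G\<^esub> (g [^]\<^bsub>G\<^esub> r) = \<phi> (t [^]\<^bsub>H\<^esub> r)"
    using \<pi>.hom_nat_pow[OF g(1), of r] \<phi>.hom_nat_pow[OF t(1), of r] g(2) by simp
  also have "\<dots> = ?N" using t(3) \<phi>.hom_one by simp
  finally have "g [^]\<^bsub>G\<^esub> r \<in> ?N"
    using G.r_coset_eq_iff[OF N.subgroup_axioms _ G.one_closed, of "g [^]\<^bsub>G\<^esub> r"] g(1) N.subset by simp
  then obtain z where z: "z \<in> carrier G" "g [^]\<^bsub>G\<^esub> r = z [^]\<^bsub>G\<^esub> (r * s)"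
    unfolding q_def by (rule G.power_subgroup_even)
  then have "g [^]\<^bsub>G\<^esub> r = (z [^]\<^bsub>G\<^esub> s) [^]\<^bsub>G\<^esub> r" by (simp add: G.nat_pow_pow mult.commute)
  then have gz: "g = z [^]\<^bsub>G\<^esub> s" using G.root_unique[OF g(1) _ _ t(4)] z(1) by blast
  obtain y where y: "y \<in> carrier H" "\<phi> y = ?N #>\<^bsub>G\<^esub> z"
    using \<phi>(2) z(1) by (metis (no_types, lifting) carrier_FactGroup image_iff)
  have "\<phi> t = \<phi> (y [^]\<^bsub>H\<^esub> s)"
    using \<phi>.hom_nat_pow[OF y(1), of s] \<pi>.hom_nat_pow[OF z(1), of s] y(2) g(2) gz by simp
  then have "?M #>\<^bsub>H\<^esub> t = ?M #>\<^bsub>H\<^esub> (y [^]\<^bsub>H\<^esub> s)"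
    by (rule inj[OF t(1) H.nat_pow_closed[OF y(1)]])
  then have m: "t \<otimes>\<^bsub>H\<^esub> inv\<^bsub>H\<^esub> (y [^]\<^bsub>H\<^esub> s) \<in> ?M"
    using H.r_coset_eq_iff[OF M.subgroup_axioms t(1)] y(1) by simp
  have P: "subgroup (power_subgroup H s) H" by (rule normal_imp_subgroup[OF H.power_subgroup_normal])
  have "?M \<subseteq> power_subgroup H s"
    unfolding power_subgroup_def[of H q]
  proof (rule H.generate_subgroup_incl[OF _ P], rule image_subsetI)
    fix w assume w: "w \<in> carrier H"
    have "w [^]\<^bsub>H\<^esub> q = (w [^]\<^bsub>H\<^esub> (2 * r)) [^]\<^bsub>H\<^esub> s"
      using w by (simp add: H.nat_pow_pow q_def mult.assoc)
    then show "w [^]\<^bsub>H\<^esub> q \<in> power_subgroup H s" using H.power_in_power_subgroup w by simp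
  qed
  then have "t \<otimes>\<^bsub>H\<^esub> inv\<^bsub>H\<^esub> (y [^]\<^bsub>H\<^esub> s) \<otimes>\<^bsub>H\<^esub> y [^]\<^bsub>H\<^esub> s \<in> power_subgroup H s"
    using m H.power_in_power_subgroup[OF y(1)] subgroup.m_closed[OF P] by blast
  then show False using s(2) t(1) y(1) by (simp add: H.m_assoc)
qed

text \<open>In each half, a finite image is bounded from below by the coordinates of
  \<open>G\<close> and from above by those of \<open>H\<close>. Exchanging the groups gives the
  opposite inequalities.\<close>

lemma rank_le:
  assumes G: "tf_class_two_group G" and H: "tf_class_two_group H" and eq: "Con G = Con H"
    and coG: "coords G (carrier G) (tau G) n \<alpha>" "coords G (tau G) {\<one>\<^bsub>G\<^esub>} m \<beta>"
    and coH: "coords H (carrier H) (tau H) n' \<alpha>'" "coords H (tau H) {\<one>\<^bsub>H\<^esub>} m' \<beta>'"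
  shows "n \<le> n'" "m \<le> m'"
proof -
  interpret G: tf_class_two_group G by fact
  interpret H: tf_class_two_group H by fact
  obtain d :: nat where d: "d > 0" "\<And>z. z \<in> tau G \<Longrightarrow> z [^]\<^bsub>G\<^esub> d \<in> derived G (carrier G)"
    using G.tau_exponent by blast
  obtain e :: nat where e: "e > 0" "\<And>z. z \<in> tau H \<Longrightarrow> z [^]\<^bsub>H\<^esub> e \<in> derived H (carrier H)"
    using H.tau_exponent by blast
  \<comment> \<open>With this q the q-th power of x is x times x^(2de), and x^(2de) lies in the
    derived subgroup if x lies in \<open>tau G\<close> or \<open>tau H\<close>. Oddness is for
    \<open>power_subgroup_odd\<close>, and q > 1 for comparing exponents.\<close>
  define q where "q = Suc (2 * (d * e))"
  have q: "q > 0" "q > 1" "odd q" using d e unfolding q_def by auto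
  note sG = normal_imp_subgroup[OF G.normal_self] and sH = normal_imp_subgroup[OF H.normal_self]
  show "n \<le> n'"
  proof -
    \<comment> \<open>The product of \<open>tau G\<close> with the q-th powers, in coordinates. It
      contains the derived subgroup, hence is normal, and its quotient has exponent dividing
      q.\<close>
    define N where "N = {x \<in> carrier G. \<forall>i<n. int q dvd \<alpha> x i}"
    have derN: "derived G (carrier G) \<subseteq> N"
    proof
      fix x assume x: "x \<in> derived G (carrier G)"
      then have "x \<in> carrier G" "x \<in> tau G"
        using G.derived_subset_tau G.derived_in_carrier[OF subset_refl] by blast+
      moreover from this have "\<forall>i<n. \<alpha> x i = 0" using coG(1) unfolding coords_def by blast
      ultimately show "x \<in> N" unfolding N_def by simp
    qed
    have "subgroup N G"
    proof (rule G.subgroupI)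
      show "N \<noteq> {}" using derN subgroup.one_closed[OF G.derived_is_subgroup[OF subset_refl]] by blast
      show "inv\<^bsub>G\<^esub> a \<in> N" if "a \<in> N" for a
        using that G.coords_inv[OF sG coG(1)] unfolding N_def by simp
      show "a \<otimes>\<^bsub>G\<^esub> b \<in> N" if "a \<in> N" "b \<in> N" for a b
        using that G.coords_mult[OF coG(1)] unfolding N_def by simp
    qed (auto simp: N_def)
    then have N: "N \<lhd> G" using G.subgroup_derived_imp_normal derN by blast
    interpret N: normal N G by fact
    have pow: "x [^]\<^bsub>G\<^esub> q \<in> N" if "x \<in> carrier G" for x
      using that G.coords_pow[OF sG coG(1)] unfolding N_def by simp
    have fin: "finite (rcosets\<^bsub>G\<^esub> N)" by (rule G.finite_rcosets_exponent[OF N q(1) pow])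
    obtain \<phi> where \<phi>: "\<phi> \<in> hom H (G Mod N)" "\<phi> ` carrier H = carrier (G Mod N)"
      using finite_quotient_transfer[OF G.fg H.is_group eq N fin] .
    interpret \<phi>: group_hom H "G Mod N" \<phi>
      using \<phi> N.factorgroup_is_group by (simp add: group_hom_def group_hom_axioms_def H.is_group)
    have img: "carrier (G Mod N) = (\<lambda>x. N #>\<^bsub>G\<^esub> x) ` carrier G" by (rule carrier_FactGroup)
    have der: "\<phi> z = \<one>\<^bsub>G Mod N\<^esub>" if "z \<in> derived H (carrier H)" for z
    proof -
      have "\<phi> z \<in> (\<lambda>x. N #>\<^bsub>G\<^esub> x) ` derived G (carrier G)"
        using quotient_derived_image[OF G.is_group H.is_group N \<phi>] that by blast
      then show ?thesis using derN N.rcos_const[OF G.is_group] by auto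
    qed
    note [simp del] = one_FactGroup mult_FactGroup
    have powq: "\<phi> u [^]\<^bsub>G Mod N\<^esub> q = \<one>\<^bsub>G Mod N\<^esub>" if "u \<in> carrier H" for u
      using N.quotient_exponent[OF pow] \<phi>.hom_closed[OF that] by blast
    \<comment> \<open>The image of z is killed by e, since z^e lies in the derived subgroup, and by
      q; these exponents are coprime.\<close>
    have kill: "\<phi> z = \<one>\<^bsub>G Mod N\<^esub>" if z: "z \<in> tau H" for z
    proof -
      have zc: "z \<in> carrier H" using z unfolding tau_def by blast
      have "\<phi> (z [^]\<^bsub>H\<^esub> e) = \<one>\<^bsub>G Mod N\<^esub>" using der e z by blast
      then have "\<phi> z [^]\<^bsub>G Mod N\<^esub> e = \<one>\<^bsub>G Mod N\<^esub>" using \<phi>.hom_nat_pow[OF zc, of e] by simp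
      then have "(\<phi> z [^]\<^bsub>G Mod N\<^esub> e) [^]\<^bsub>G Mod N\<^esub> (2 * d) = \<one>\<^bsub>G Mod N\<^esub>" by simp
      then have "\<phi> z [^]\<^bsub>G Mod N\<^esub> (2 * (d * e)) = \<one>\<^bsub>G Mod N\<^esub>"
        using zc by (simp add: \<phi>.H.nat_pow_pow ac_simps)
      then show ?thesis using powq[OF zc] zc unfolding q_def by simp
    qed
    have "\<phi> (y \<otimes>\<^bsub>H\<^esub> u [^]\<^bsub>H\<^esub> q \<otimes>\<^bsub>H\<^esub> z) = \<phi> y"
      if "y \<in> carrier H" "u \<in> carrier H" "z \<in> tau H" "z \<in> carrier H" for y u z
      using that kill[OF that(3)] powq[OF that(2)] by (simp add: \<phi>.hom_nat_pow)
    note upper = H.coords_card_upper[of _ _ _ _ _ \<phi>, OF sH coH(1) q(1) this]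
    have "q ^ n \<le> card ((\<lambda>x. N #>\<^bsub>G\<^esub> x) ` carrier G)"
    proof (rule G.coords_card_lower[OF coG(1) q(1)])
      show "finite ((\<lambda>x. N #>\<^bsub>G\<^esub> x) ` carrier G)" using upper(1) \<phi>(2) img by simp
      fix x y i assume *: "x \<in> carrier G" "y \<in> carrier G" "N #>\<^bsub>G\<^esub> x = N #>\<^bsub>G\<^esub> y" "i < n"
      then have "x \<otimes>\<^bsub>G\<^esub> inv\<^bsub>G\<^esub> y \<in> N" using G.r_coset_eq_iff[OF N.subgroup_axioms] by blast
      then show "int q dvd \<alpha> x i - \<alpha> y i"
        using * G.coords_mult[OF coG(1), of x "inv\<^bsub>G\<^esub> y" i] G.coords_inv[OF sG coG(1), of y i]
        unfolding N_def by auto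
    qed
    then have "q ^ n \<le> q ^ n'" using upper(2) \<phi>(2) img by simp
    then show ?thesis using q(2) power_le_imp_le_exp by blast
  qed
  show "m \<le> m'"
  proof -
    let ?N = "power_subgroup G q"
    interpret N: normal ?N G by (rule G.power_subgroup_normal)
    have fin: "finite (rcosets\<^bsub>G\<^esub> ?N)"
      by (rule G.finite_rcosets_exponent[OF N.normal_axioms q(1) G.power_in_power_subgroup])
    obtain \<phi> where \<phi>: "\<phi> \<in> hom H (G Mod ?N)" "\<phi> ` carrier H = carrier (G Mod ?N)"
      using finite_quotient_transfer[OF G.fg H.is_group eq N.normal_axioms fin] .
    interpret \<phi>: group_hom H "G Mod ?N" \<phi>
      using \<phi> N.factorgroup_is_group by (simp add: group_hom_def group_hom_axioms_def H.is_group)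
    interpret \<pi>: group_hom G "G Mod ?N" "\<lambda>x. ?N #>\<^bsub>G\<^esub> x"
      using N.factorgroup_is_group N.r_coset_hom_Mod by (simp add: group_hom_def group_hom_axioms_def G.is_group)
    note [simp del] = one_FactGroup mult_FactGroup
    have tG: "tau G \<subseteq> carrier G" and tH: "tau H \<subseteq> carrier H" unfolding tau_def by auto
    have "\<phi> (y \<otimes>\<^bsub>H\<^esub> u [^]\<^bsub>H\<^esub> q \<otimes>\<^bsub>H\<^esub> z) = \<phi> y"
      if *: "y \<in> tau H" "u \<in> tau H" "z \<in> {\<one>\<^bsub>H\<^esub>}" "z \<in> tau H" for y u z
    proof -
      have c: "y \<in> carrier H" "u \<in> carrier H" using * tH by auto
      have "\<phi> u [^]\<^bsub>G Mod ?N\<^esub> q = \<one>\<^bsub>G Mod ?N\<^esub>"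
        using N.quotient_exponent[OF G.power_in_power_subgroup] \<phi>.hom_closed[OF c(2)] by blast
      then show ?thesis using * c by (simp add: \<phi>.hom_nat_pow)
    qed
    note upper = H.coords_card_upper[of _ _ _ _ _ \<phi>, OF H.subgroup_tau coH(2) q(1) this]
    \<comment> \<open>The isolator has no direct meaning in the finite quotient, but the derived
      subgroup has: modulo \<open>?N\<close> each x in \<open>tau G\<close> agrees with an element
      of the derived subgroup, and derived subgroups correspond under \<phi>.\<close>
    have sub: "(\<lambda>x. ?N #>\<^bsub>G\<^esub> x) ` tau G \<subseteq> \<phi> ` tau H"
    proof (rule image_subsetI)
      fix x assume x: "x \<in> tau G"
      then have xc: "x \<in> carrier G" using tG by blast
      \<comment> \<open>This is x^(-2de), so x = x^q w is congruent to w modulo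
        \<open>?N\<close>.\<close>
      define w where "w = inv\<^bsub>G\<^esub> ((x [^]\<^bsub>G\<^esub> d) [^]\<^bsub>G\<^esub> (2 * e))"
      have D: "subgroup (derived G (carrier G)) G" by (rule G.derived_is_subgroup) simp
      have w: "w \<in> derived G (carrier G)"
        unfolding w_def using D d(2)[OF x] G.subgroup_nat_pow_closed subgroup.m_inv_closed by metis
      have "x [^]\<^bsub>G\<^esub> q \<otimes>\<^bsub>G\<^esub> w = x"
      proof -
        have "(x [^]\<^bsub>G\<^esub> d) [^]\<^bsub>G\<^esub> (2 * e) = x [^]\<^bsub>G\<^esub> (2 * (d * e))"
          using xc by (simp add: G.nat_pow_pow mult.left_commute)
        moreover have "x [^]\<^bsub>G\<^esub> q = x \<otimes>\<^bsub>G\<^esub> x [^]\<^bsub>G\<^esub> (2 * (d * e))"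
          unfolding q_def using xc by (rule G.nat_pow_Suc2)
        ultimately show ?thesis unfolding w_def using xc by (simp add: G.m_assoc)
      qed
      moreover have "x [^]\<^bsub>G\<^esub> q \<otimes>\<^bsub>G\<^esub> w \<otimes>\<^bsub>G\<^esub> inv\<^bsub>G\<^esub> w \<in> ?N"
        using xc w subgroup.mem_carrier[OF D] G.power_in_power_subgroup by (simp add: G.m_assoc)
      ultimately have "?N #>\<^bsub>G\<^esub> x = ?N #>\<^bsub>G\<^esub> w"
        using G.r_coset_eq_iff[OF N.subgroup_axioms xc] w subgroup.mem_carrier[OF D] by auto
      also have "\<dots> \<in> \<phi> ` derived H (carrier H)"
        using quotient_derived_image[OF G.is_group H.is_group N.normal_axioms \<phi>] w by blast
      finally show "?N #>\<^bsub>G\<^esub> x \<in> \<phi> ` tau H" using H.derived_subset_tau by blast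
    qed
    have "q ^ m \<le> card ((\<lambda>x. ?N #>\<^bsub>G\<^esub> x) ` tau G)"
    proof (rule G.coords_card_lower[OF coG(2) q(1)])
      show "finite ((\<lambda>x. ?N #>\<^bsub>G\<^esub> x) ` tau G)" using sub upper(1) finite_subset by blast
      fix x y i assume *: "x \<in> tau G" "y \<in> tau G" "?N #>\<^bsub>G\<^esub> x = ?N #>\<^bsub>G\<^esub> y" "i < m"
      then have c: "x \<in> carrier G" "y \<in> carrier G" using tG by auto
      have "x \<otimes>\<^bsub>G\<^esub> inv\<^bsub>G\<^esub> y \<in> ?N" using G.r_coset_eq_iff[OF N.subgroup_axioms c] * by blast
      then obtain w where w: "w \<in> carrier G" "x \<otimes>\<^bsub>G\<^esub> inv\<^bsub>G\<^esub> y = w [^]\<^bsub>G\<^esub> q"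
        by (rule G.power_subgroup_odd[OF q(3)])
      have iy: "inv\<^bsub>G\<^esub> y \<in> tau G" using *(2) subgroup.m_inv_closed[OF G.subgroup_tau] by blast
      then have "w [^]\<^bsub>G\<^esub> q \<in> tau G"
        using w(2) *(1) subgroup.m_closed[OF G.subgroup_tau] by metis
      \<comment> \<open>A q-th root of an element of \<open>tau G\<close> is again in
        \<open>tau G\<close>, so its \<beta>-coordinates are available.\<close>
      then have wt: "w \<in> tau G" using G.pow_tau_imp_tau w(1) q(1) by blast
      have "\<beta> x i - \<beta> y i = int q * \<beta> w i"
        using G.coords_mult[OF coG(2) *(1) iy *(4)] G.coords_inv[OF G.subgroup_tau coG(2) *(2,4)]
          G.coords_pow[OF G.subgroup_tau coG(2) wt *(4), of q] w(2) by simp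
      then show "int q dvd \<beta> x i - \<beta> y i" by simp
    qed
    also have "\<dots> \<le> card (\<phi> ` tau H)" using sub upper(1) by (intro card_mono)
    also have "\<dots> \<le> q ^ m'" by (rule upper(2))
    finally show ?thesis using q(2) power_le_imp_le_exp by blast
  qed
qed

lemma class_I_imp_tf_class_two_group:
  assumes "class_I n m G"
  shows "tf_class_two_group G"
proof -
  interpret group G using assms unfolding class_I_def finitely_generated_def by blast
  interpret class_two_group G
    using assms nilpotent_of_class_2_iff unfolding class_I_def by blast
  show ?thesis by unfold_locales (use assms in \<open>auto simp: class_I_def\<close>)
qed

section \<open>Commutator laws and the conclusion\<close>

lemma word_val_triple_comm:
  assumes "group K" "set gs \<subseteq> carrier K" "length gs \<ge> 3"
  shows "word_val K gs [(0, True), (1, True), (0, False), (1, False), (2, True),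
      (1, True), (0, True), (1, False), (0, False), (2, False)] =
    comm K (comm K (gs ! 0) (gs ! 1)) (gs ! 2)"
proof -
  interpret K: group K by fact
  have "gs ! 0 \<in> carrier K" "gs ! 1 \<in> carrier K" "gs ! 2 \<in> carrier K"
    using assms(3) by (auto intro!: subsetD[OF assms(2)] nth_mem)
  then show ?thesis by (simp add: K.m_assoc K.inv_mult_group)
qed

lemma word_val_comm:
  assumes "group K" "set gs \<subseteq> carrier K" "length gs \<ge> 2"
  shows "word_val K gs [(0, True), (1, True), (0, False), (1, False)] = comm K (gs ! 0) (gs ! 1)"
proof -
  interpret K: group K by fact
  have "gs ! 0 \<in> carrier K" "gs ! 1 \<in> carrier K"
    using assms(3) by (auto intro!: subsetD[OF assms(2)] nth_mem)
  then show ?thesis by (simp add: K.m_assoc)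
qed

lemma (in group) comm_eq_one_iff:
  assumes "x \<in> carrier G" "y \<in> carrier G"
  shows "comm G x y = \<one> \<longleftrightarrow> x \<otimes> y = y \<otimes> x"
proof
  assume "comm G x y = \<one>"
  then have "comm G x y \<otimes> (y \<otimes> x) = y \<otimes> x" using assms by simp
  then show "x \<otimes> y = y \<otimes> x" using assms by (simp add: m_assoc)
qed (use assms in \<open>simp add: m_assoc\<close>)

text \<open>Centrality of commutators is the law [[x,y],z] = 1 in three variables. The word spells
  the inner commutator, z, the inverse of the inner commutator, and the inverse of z.\<close>

lemma class_two_transfer:
  assumes G: "class_two_group G" and H: "finitely_generated H" and eq: "Con G = Con H"
  shows "class_two_group H"
proof -
  interpret G: class_two_group G by fact
  interpret H: group H using H unfolding finitely_generated_def by blast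
  let ?w = "[(0, True), (1, True), (0, False), (1, False), (2, True),
    (1, True), (0, True), (1, False), (0, False), (2, False)] :: (nat \<times> bool) list"
  have law: "word_val G gs ?w = \<one>\<^bsub>G\<^esub>" if gs: "set gs \<subseteq> carrier G" "length gs \<ge> 3" for gs
  proof -
    have "gs ! 0 \<in> carrier G" "gs ! 1 \<in> carrier G" "gs ! 2 \<in> carrier G"
      using gs(2) by (auto intro!: subsetD[OF gs(1)] nth_mem)
    then show ?thesis
      unfolding word_val_triple_comm[OF G.is_group gs]
      by (subst G.comm_eq_one_iff) (auto intro: G.comm_commutes)
  qed
  show ?thesis
  proof unfold_locales
    fix x y assume xy: "x \<in> carrier H" "y \<in> carrier H"
    have "comm H x y \<otimes>\<^bsub>H\<^esub> z = z \<otimes>\<^bsub>H\<^esub> comm H x y" if z: "z \<in> carrier H" for z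
    proof -
      have hs: "set [x, y, z] \<subseteq> carrier H" using xy z by simp
      have "word_val H [x, y, z] ?w = \<one>\<^bsub>H\<^esub>"
        by (rule law_transfer[OF G.is_group H eq _ law hs]) auto
      then have "comm H (comm H x y) z = \<one>\<^bsub>H\<^esub>"
        using word_val_triple_comm[OF H.is_group hs] by (simp add: numeral_2_eq_2 del: word_val.simps)
      then show ?thesis using H.comm_eq_one_iff[of "comm H x y" z] xy z by simp
    qed
    then show "comm H x y \<in> center H" using xy unfolding center_def by simp
  qed
qed

text \<open>Being non-abelian is not a law; it passes to \<open>H\<close> by contraposition, with
  this lemma applied from \<open>H\<close> to \<open>G\<close>.\<close>

lemma abelian_transfer:
  assumes G: "group G" and H: "finitely_generated H" and eq: "Con G = Con H"
    and ab: "derived G (carrier G) = {\<one>\<^bsub>G\<^esub>}"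
  shows "derived H (carrier H) = {\<one>\<^bsub>H\<^esub>}"
proof -
  interpret G: group G by fact
  interpret H: group H using H unfolding finitely_generated_def by blast
  let ?w = "[(0, True), (1, True), (0, False), (1, False)] :: (nat \<times> bool) list"
  have law: "word_val G gs ?w = \<one>\<^bsub>G\<^esub>" if gs: "set gs \<subseteq> carrier G" "length gs \<ge> 2" for gs
  proof -
    have "gs ! 0 \<in> carrier G" "gs ! 1 \<in> carrier G"
      using gs(2) by (auto intro!: subsetD[OF gs(1)] nth_mem)
    then have "comm G (gs ! 0) (gs ! 1) \<in> derived G (carrier G)"
      unfolding derived_def by (intro generate.incl) blast
    then show ?thesis unfolding word_val_comm[OF G.is_group gs] ab by blast
  qed
  have "comm H x y = \<one>\<^bsub>H\<^esub>" if "x \<in> carrier H" "y \<in> carrier H" for x y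
  proof -
    have hs: "set [x, y] \<subseteq> carrier H" using that by simp
    have "word_val H [x, y] ?w = \<one>\<^bsub>H\<^esub>"
      by (rule law_transfer[OF G.is_group H eq _ law hs]) auto
    then show ?thesis
      using word_val_comm[OF H.is_group hs] by (simp del: word_val.simps)
  qed
  then have "derived_set H (carrier H) \<subseteq> {\<one>\<^bsub>H\<^esub>}" by blast
  then show ?thesis
    unfolding derived_def using H.generate_subgroup_incl[OF _ H.triv_subgroup] generate.one by blast
qed

theorem lemma2p6:
  fixes G :: "('a, 'c) monoid_scheme" and H :: "('b, 'd) monoid_scheme" and n m :: nat
  assumes "n \<ge> 1" and "m \<ge> 1"
    and "class_I n m G"
    and "finitely_generated H"
    and "config_equivalent G H"
  shows "class_I n m H"
proof -
  have eq: "Con G = Con H" using assms(5) unfolding config_equivalent_def .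
  have G: "tf_class_two_group G" by (rule class_I_imp_tf_class_two_group[OF assms(3)])
  interpret G: tf_class_two_group G by (rule G)
  interpret H2: class_two_group H by (rule class_two_transfer[OF G.class_two_group_axioms assms(4) eq])
  have H: "fg_class_two_group H" by unfold_locales (rule assms(4))
  interpret H: tf_class_two_group H
    using torsion_free_transfer[OF G H eq] H
    by (simp add: tf_class_two_group_def tf_class_two_group_axioms_def)
  have "derived G (carrier G) \<noteq> {\<one>\<^bsub>G\<^esub>}"
    using assms(3) G.nilpotent_of_class_2_iff unfolding class_I_def by blast
  then have "derived H (carrier H) \<noteq> {\<one>\<^bsub>H\<^esub>}"
    using abelian_transfer[OF H2.is_group G.fg eq[symmetric]] by blast
  then obtain n' m' where H': "class_I n' m' H" by (rule H.exists_class_I)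
  obtain \<alpha> \<beta> where coG: "coords G (carrier G) (tau G) n \<alpha>" "coords G (tau G) {\<one>\<^bsub>G\<^esub>} m \<beta>"
    using G.iso_coords assms(3) unfolding class_I_def by blast
  obtain \<alpha>' \<beta>' where coH: "coords H (carrier H) (tau H) n' \<alpha>'" "coords H (tau H) {\<one>\<^bsub>H\<^esub>} m' \<beta>'"
    using H.iso_coords H' unfolding class_I_def by blast
  have "n = n'" "m = m'"
    using rank_le[OF G H.tf_class_two_group_axioms eq coG coH]
      rank_le[OF H.tf_class_two_group_axioms G eq[symmetric] coH coG] by simp_all
  with H' show ?thesis by simp
qed

end
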